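(* Let $k\ge 4$ be an integer and let $s$ be an integer with $1\le s\le \frac14 (k+1)^2$. Then for each $\varepsilon>0$ one has $$J_{s,k}(X)\ll X^{s+\varepsilon},$$ where the implicit constant may depend on $s$, $k$ and $\varepsilon$.
   Context: For natural numbers $k,s$ and real $X\ge 1$, $J_{s,k}(X)$ denotes the number of integral solutions $(x_1,\dots,x_s,y_1,\dots,y_s)$ of the system $\sum_{i=1}^s (x_i^j-y_i^j)=0$ $(1\le j\le k)$ with $1\le x_i,y_i\le X$ $(1\le i\le s)$. *)

theory Defs
  imports Complex_Main "HOL-Library.FuncSet"
begin

text \<open>
  An \<open>s\<close>-tuple is an extensional function on \<open>{1..s}\<close>, so that tuples agreeing on
  \<open>{1..s}\<close> are equal and counted once.
\<close>

definition vinogradov_solutions ::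
  "nat \<Rightarrow> nat \<Rightarrow> real \<Rightarrow> ((nat \<Rightarrow> int) \<times> (nat \<Rightarrow> int)) set" where
  "vinogradov_solutions s k X =
     {(x, y). x \<in> {1..s} \<rightarrow>\<^sub>E {n. 1 \<le> n \<and> real_of_int n \<le> X} \<and>
              y \<in> {1..s} \<rightarrow>\<^sub>E {n. 1 \<le> n \<and> real_of_int n \<le> X} \<and>
              (\<forall>j\<in>{1..k}. (\<Sum>i=1..s. x i ^ j - y i ^ j) = 0)}"

definition vinogradov_J :: "nat \<Rightarrow> nat \<Rightarrow> real \<Rightarrow> nat" where
  "vinogradov_J s k X = card (vinogradov_solutions s k X)"

lemma finite_vinogradov_solutions: "finite (vinogradov_solutions s k X)"
proof -
  have "{n. 1 \<le> n \<and> real_of_int n \<le> X} \<subseteq> {1..\<lfloor>X\<rfloor>}"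
    by (auto simp: le_floor_iff)
  then have "finite {n. 1 \<le> n \<and> real_of_int n \<le> X}"
    by (rule finite_subset) simp
  then have "finite (({1..s} \<rightarrow>\<^sub>E {n. 1 \<le> n \<and> real_of_int n \<le> X}) \<times>
                     ({1..s} \<rightarrow>\<^sub>E {n. 1 \<le> n \<and> real_of_int n \<le> X}))"
    by (intro finite_cartesian_product finite_PiE) auto
  then show ?thesis
    by (rule rev_finite_subset) (auto simp: vinogradov_solutions_def)
qed

end

theory Submission
  imports Defs "HOL-Number_Theory.Cong" "HOL-Computational_Algebra.Polynomial" "HOL-Analysis.Convex"
begin

text \<open>
  Work with \<open>X = p\<^sup>M\<close> for a fixed large prime \<open>p\<close> and put \<open>s = r t\<close> with \<open>r + t = k + 1\<close>,
  \<open>r \<le> t\<close>, \<open>m = s - r\<close>. Suppose \<open>J\<^sub>s\<close> is bounded with exponent \<open>s + \<Delta>\<close>, \<open>\<Delta> > 0\<close>, and consider the mixed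
  mean values of \<open>\<bar>f\<^sub>a(\<xi>)\<bar>\<^bsup>2m\<^esup> \<bar>f\<^sub>b(\<eta>)\<bar>\<^bsup>2r\<^esup>\<close>, where \<open>f\<^sub>a(\<xi>)\<close> is the exponential sum over the
  residue class of \<open>\<xi>\<close> modulo \<open>p\<^sup>a\<close>, \<open>a < b\<close> and \<open>\<xi>, \<eta>\<close> are distinct modulo \<open>p\<close>.
  Pointwise, either one class modulo \<open>p\<^bsup>a+1\<^esup>\<close> dominates \<open>f\<^sub>a(\<xi>)\<close>, which is profitable because
  \<open>2m\<close> is large, or \<open>r\<close> distinct classes contribute comparably. In the latter case the equations of degree
  \<open>t, \<dots>, k\<close> hold modulo \<open>p\<^bsup>tb\<^esup>\<close> for the \<open>r\<close> variables from these classes, which forces the variables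
  themselves to agree modulo \<open>p\<^bsup>tb-(r-1)a\<^esup>\<close>. By Hoelder's inequality the pair \<open>(a, b)\<close> is
  thus replaced by \<open>(b, tb-(t-1)a)\<close>, and each replacement saves a power of \<open>p\<close> proportional to \<open>\<Delta> a\<close>.
  After boundedly many replacements the saving exceeds the trivial loss incurred in passing from \<open>J\<^sub>s\<close>
  to the mixed mean values, so that \<open>\<Delta>\<close> can be decreased by a fixed amount.
\<close>

subsection \<open>Exponential sums and power sum equations\<close>

definition char_sum :: "nat \<Rightarrow> nat \<Rightarrow> (nat \<Rightarrow> nat) \<Rightarrow> int set \<Rightarrow> complex" where
  "char_sum k N \<alpha> X = (\<Sum>x\<in>X. cis (2 * pi * (\<Sum>j=1..k. real (\<alpha> j) * of_int x ^ j) / N))"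

text \<open>
  The average over \<open>(\<int>/N)\<^sup>k\<close> replaces the integral over the torus: the two agree on the trigonometric
  polynomials that occur once \<open>N\<close> exceeds all differences of power sums.
\<close>
definition mean :: "nat \<Rightarrow> nat \<Rightarrow> ((nat \<Rightarrow> nat) \<Rightarrow> 'b::real_normed_field) \<Rightarrow> 'b" where
  "mean k N F = (\<Sum>\<alpha>\<in>{1..k} \<rightarrow>\<^sub>E {..<N}. F \<alpha>) / of_nat (N ^ k)"

text \<open>Each variable has its own range and the index type is free, so the same count also
  covers products of exponential sums over different residue classes.\<close>

definition power_sum_solutions :: "nat \<Rightarrow> 'i set \<Rightarrow> ('i \<Rightarrow> int set) \<Rightarrow> (('i \<Rightarrow> int) \<times> ('i \<Rightarrow> int)) set" where
  "power_sum_solutions k I X =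
    {(x, y). x \<in> Pi\<^sub>E I X \<and> y \<in> Pi\<^sub>E I X \<and> (\<forall>j\<in>{1..k}. (\<Sum>i\<in>I. x i ^ j) = (\<Sum>i\<in>I. y i ^ j))}"

lemma cis_sum: "cis (\<Sum>i\<in>I. f i) = (\<Prod>i\<in>I. cis (f i))"
  by (induction I rule: infinite_finite_induct) (auto simp flip: cis_mult)

text \<open>A geometric series in the \<open>N\<close>-th root of unity \<open>\<omega>\<close>; the
  conditions on \<open>v\<close> keep \<open>N\<close> from dividing it, so \<open>\<omega>\<close>
  is not 1.\<close>

lemma sum_cis_eq_0:
  fixes v :: int
  assumes "v \<noteq> 0" "\<bar>v\<bar> < int N"
  shows "(\<Sum>a<N. cis (2 * pi * (real a * of_int v) / N)) = 0"
proof -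
  define \<omega> where "\<omega> = cis (2 * pi * of_int v / N)"
  have N: "N > 0" using assms by linarith
  have "\<omega> ^ N = cis (2 * pi * of_int v)"
    using N by (simp add: \<omega>_def DeMoivre)
  then have "\<omega> ^ N = 1" by simp
  then have "(1 - \<omega>) * (\<Sum>a<N. \<omega> ^ a) = 0"
    by (metis one_diff_power_eq right_minus_eq)
  moreover have "\<omega> \<noteq> 1"
  proof
    assume "\<omega> = 1"
    then have "cos (2 * pi * of_int v / N) = 1"
      by (metis \<omega>_def cis.simps(1) one_complex.simps(1))
    then obtain n :: int where "2 * pi * of_int v / N = of_int n * 2 * pi"
      by (auto simp: cos_one_2pi_int)
    then have "real_of_int v = of_int (n * int N)"
      using N by (simp add: field_simps)
    then have "v = n * int N" by linarith
    then show False
      using assms N by (auto simp: abs_mult)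
  qed
  ultimately have "(\<Sum>a<N. \<omega> ^ a) = 0" by simp
  moreover have "cis (2 * pi * (real a * of_int v) / N) = \<omega> ^ a" for a
    by (simp add: \<omega>_def DeMoivre mult_ac)
  ultimately show ?thesis by simp
qed

text \<open>The average factors over the coordinates of \<open>\<alpha>\<close>, and a single
  coordinate with \<open>v j \<noteq> 0\<close> makes the whole product vanish.\<close>

lemma mean_cis:
  fixes v :: "nat \<Rightarrow> int"
  assumes "\<And>j. j \<in> {1..k} \<Longrightarrow> \<bar>v j\<bar> < int N" "0 < N"
  shows "mean k N (\<lambda>\<alpha>. cis (2 * pi * (\<Sum>j=1..k. real (\<alpha> j) * of_int (v j)) / N))
    = (if \<forall>j\<in>{1..k}. v j = 0 then 1 else 0)"
proof -
  have "mean k N (\<lambda>\<alpha>. cis (2 * pi * (\<Sum>j=1..k. real (\<alpha> j) * of_int (v j)) / N))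
    = (\<Prod>j=1..k. \<Sum>a<N. cis (2 * pi * (real a * of_int (v j)) / N)) / of_nat (N ^ k)"
    by (simp add: mean_def prod_sum_PiE cis_sum sum_distrib_left sum_divide_distrib)
  also have "\<dots> = (if \<forall>j\<in>{1..k}. v j = 0 then 1 else 0)"
  proof (cases "\<forall>j\<in>{1..k}. v j = 0")
    case True
    then show ?thesis using assms(2) by simp
  next
    case False
    then obtain j where j: "j \<in> {1..k}" "v j \<noteq> 0" by blast
    then have "(\<Sum>a<N. cis (2 * pi * (real a * of_int (v j)) / N)) = 0"
      using assms by (intro sum_cis_eq_0) auto
    then have "(\<Prod>j=1..k. \<Sum>a<N. cis (2 * pi * (real a * of_int (v j)) / N)) = 0"
      using j(1) by (intro prod_zero) auto
    then show ?thesis using False by auto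
  qed
  finally show ?thesis .
qed

lemma mean_sum: "mean k N (\<lambda>\<alpha>. \<Sum>x\<in>A. F x \<alpha>) = (\<Sum>x\<in>A. mean k N (F x))"
  unfolding mean_def by (simp add: sum_divide_distrib sum.swap[of _ _ A])

text \<open>Expanding the squares gives one character for each pair of tuples, with frequency the
  difference \<open>v\<close> of their power sums. All these power sums lie between 0 and
  \<open>card I * L ^ k\<close>, so \<open>N\<close> exceeds every difference and orthogonality
  detects genuine equality, not just congruence modulo \<open>N\<close>.\<close>

lemma mean_norm_char_sum:
  fixes X :: "'i \<Rightarrow> int set"
  assumes I: "finite I" and X: "\<And>i. i \<in> I \<Longrightarrow> X i \<subseteq> {0..<int L}" and N: "card I * L ^ k < N" "0 < N"
    and L: "0 < L"
  shows "mean k N (\<lambda>\<alpha>. \<Prod>i\<in>I. (norm (char_sum k N \<alpha> (X i)))\<^sup>2) = real (card (power_sum_solutions k I X))"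
proof -
  define \<phi> where "\<phi> \<alpha> x = cis (2 * pi * (\<Sum>j=1..k. real (\<alpha> j) * of_int x ^ j) / N)" for \<alpha> :: "nat \<Rightarrow> nat" and x :: int
  define v where "v x y j = (\<Sum>i\<in>I. x i ^ j) - (\<Sum>i\<in>I. y i ^ j)" for x y :: "'i \<Rightarrow> int" and j :: nat
  have finX: "finite (X i)" if "i \<in> I" for i
    using X[OF that] by (rule finite_subset) simp
  have finP: "finite (Pi\<^sub>E I X)" using I finX by (intro finite_PiE) auto
  have phi_prod: "(\<Prod>i\<in>I. \<phi> \<alpha> (x i)) * (\<Prod>i\<in>I. cnj (\<phi> \<alpha> (y i)))
    = cis (2 * pi * (\<Sum>j=1..k. real (\<alpha> j) * of_int (v x y j)) / N)" for \<alpha> x y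
  proof -
    have "(\<Prod>i\<in>I. \<phi> \<alpha> (x i)) * (\<Prod>i\<in>I. cnj (\<phi> \<alpha> (y i)))
      = cis (\<Sum>i\<in>I. 2 * pi * (\<Sum>j=1..k. real (\<alpha> j) * of_int (x i) ^ j) / N)
        * cis (\<Sum>i\<in>I. - (2 * pi * (\<Sum>j=1..k. real (\<alpha> j) * of_int (y i) ^ j) / N))"
      by (simp add: \<phi>_def cis_sum cis_cnj)
    also have "\<dots> = cis (2 * pi * (\<Sum>i\<in>I. \<Sum>j=1..k. real (\<alpha> j) * (of_int (x i) ^ j - of_int (y i) ^ j)) / N)"
      by (simp add: cis_mult sum_distrib_left sum_divide_distrib sum_subtractf sum_negf algebra_simps diff_divide_distrib)
    also have "(\<Sum>i\<in>I. \<Sum>j=1..k. real (\<alpha> j) * (of_int (x i) ^ j - of_int (y i) ^ j))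
      = (\<Sum>j=1..k. real (\<alpha> j) * of_int (v x y j))"
      by (subst sum.swap) (simp add: v_def sum_subtractf sum_distrib_left right_diff_distrib)
    finally show ?thesis .
  qed
  have expand: "complex_of_real (\<Prod>i\<in>I. (norm (char_sum k N \<alpha> (X i)))\<^sup>2)
    = (\<Sum>x\<in>Pi\<^sub>E I X. \<Sum>y\<in>Pi\<^sub>E I X. cis (2 * pi * (\<Sum>j=1..k. real (\<alpha> j) * of_int (v x y j)) / N))" for \<alpha>
  proof -
    have "complex_of_real (\<Prod>i\<in>I. (norm (char_sum k N \<alpha> (X i)))\<^sup>2)
      = (\<Prod>i\<in>I. \<Sum>x\<in>X i. \<phi> \<alpha> x) * (\<Prod>i\<in>I. \<Sum>x\<in>X i. cnj (\<phi> \<alpha> x))"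
      by (simp add: complex_norm_square \<phi>_def char_sum_def prod.distrib del: of_real_power)
    also have "\<dots> = (\<Sum>x\<in>Pi\<^sub>E I X. \<Prod>i\<in>I. \<phi> \<alpha> (x i)) * (\<Sum>y\<in>Pi\<^sub>E I X. \<Prod>i\<in>I. cnj (\<phi> \<alpha> (y i)))"
      using I finX by (simp add: prod_sum_PiE)
    finally show ?thesis by (simp add: sum_product phi_prod)
  qed
  have bound: "\<bar>v x y j\<bar> < int N" if "x \<in> Pi\<^sub>E I X" "y \<in> Pi\<^sub>E I X" "j \<in> {1..k}" for x y j
  proof -
    have *: "0 \<le> (\<Sum>i\<in>I. x i ^ j) \<and> (\<Sum>i\<in>I. x i ^ j) \<le> int (card I * L ^ k)" if "x \<in> Pi\<^sub>E I X" for x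
    proof -
      have "0 \<le> x i \<and> x i \<le> int L" if "i \<in> I" for i
        using X[OF that] PiE_mem[OF \<open>x \<in> Pi\<^sub>E I X\<close> that] by auto
      then have "0 \<le> x i ^ j \<and> x i ^ j \<le> int L ^ k" if "i \<in> I" for i
        using that \<open>j \<in> {1..k}\<close> L power_mono[of "x i" "int L" j] power_increasing[of j k "int L"]
        by fastforce
      then show ?thesis
        using sum_bounded_above[of I "\<lambda>i. x i ^ j" "int L ^ k"] by (auto intro!: sum_nonneg)
    qed
    show ?thesis using *[OF that(1)] *[OF that(2)] N unfolding v_def by linarith
  qed
  have "complex_of_real (mean k N (\<lambda>\<alpha>. \<Prod>i\<in>I. (norm (char_sum k N \<alpha> (X i)))\<^sup>2))
    = mean k N (\<lambda>\<alpha>. complex_of_real (\<Prod>i\<in>I. (norm (char_sum k N \<alpha> (X i)))\<^sup>2))"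
    by (simp add: mean_def)
  also have "\<dots> = (\<Sum>x\<in>Pi\<^sub>E I X. \<Sum>y\<in>Pi\<^sub>E I X. if \<forall>j\<in>{1..k}. v x y j = 0 then 1 else 0)"
    unfolding expand mean_sum using bound N by (intro sum.cong refl mean_cis) auto
  also have "\<dots> = (\<Sum>z\<in>Pi\<^sub>E I X \<times> Pi\<^sub>E I X. if z \<in> power_sum_solutions k I X then 1 else 0)"
    unfolding sum.cartesian_product 
  proof (intro sum.cong refl, clarify)
    fix x y assume "x \<in> Pi\<^sub>E I X" "y \<in> Pi\<^sub>E I X"
    then have "(\<forall>j\<in>{1..k}. v x y j = 0) \<longleftrightarrow> (x, y) \<in> power_sum_solutions k I X"
      by (simp add: power_sum_solutions_def v_def)
    then show "(if \<forall>j\<in>{1..k}. v x y j = 0 then 1 else 0)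
      = (if (x, y) \<in> power_sum_solutions k I X then 1 else (0::complex))" by simp
  qed
  also have "\<dots> = of_nat (card (power_sum_solutions k I X))"
  proof -
    have "{z \<in> Pi\<^sub>E I X \<times> Pi\<^sub>E I X. z \<in> power_sum_solutions k I X} = power_sum_solutions k I X"
      by (auto simp: power_sum_solutions_def)
    then show ?thesis using finP by (simp flip: sum.inter_filter)
  qed
  finally have "complex_of_real (mean k N (\<lambda>\<alpha>. \<Prod>i\<in>I. (norm (char_sum k N \<alpha> (X i)))\<^sup>2))
    = complex_of_real (real (card (power_sum_solutions k I X)))"
    unfolding of_real_of_nat_eq .
  then show ?thesis unfolding of_real_eq_iff .
qed

subsection \<open>Well-conditioned congruences\<close>

text \<open>The quadratic remainder is stated as a divisibility, which avoids denominators over the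
  integers. It linearises the congruences in the lifting step below.\<close>

lemma poly_Taylor1_dvd:
  fixes G :: "'a::idom poly"
  shows "h\<^sup>2 dvd poly G (w + h) - poly G w - h * poly (pderiv G) w"
proof (induction G)
  case 0
  then show ?case by simp
next
  case (pCons c G)
  have "poly (pCons c G) (w + h) - poly (pCons c G) w - h * poly (pderiv (pCons c G)) w
    = (w + h) * (poly G (w + h) - poly G w - h * poly (pderiv G) w) + h\<^sup>2 * poly (pderiv G) w"
    by (simp add: pderiv_pCons algebra_simps power2_eq_square)
  then show ?case
    using pCons.IH by (metis dvd_add dvd_mult dvd_triv_left)
qed

text \<open>The factor \<open>fact k\<close> clears the denominators of integration and is harmless
  modulo a prime above \<open>k\<close>. Vanishing coefficients of \<open>T\<close> stay absent, so
  no low powers are introduced.\<close>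

lemma exists_int_antiderivative:
  fixes T :: "int poly"
  assumes "degree T < k"
  obtains G where "pderiv G = smult (fact k) T" "coeff G 0 = 0" "degree G \<le> k"
    "\<And>l. coeff T l = 0 \<Longrightarrow> coeff G (Suc l) = 0"
proof
  define G where "G = (\<Sum>l<k. monom (coeff T l * (fact k div int (Suc l))) (Suc l))"
  have c: "coeff G (Suc l) = (if l < k then coeff T l * (fact k div int (Suc l)) else 0)" for l
    by (simp add: G_def coeff_sum coeff_monom)
  show "coeff G 0 = 0"
    by (simp add: G_def coeff_sum coeff_monom)
  show "coeff G (Suc l) = 0" if "coeff T l = 0" for l
    using that by (simp add: c)
  show "degree G \<le> k"
  proof (rule degree_le, intro allI impI)
    fix i assume "k < i"
    then show "coeff G i = 0" by (cases i) (auto simp: c)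
  qed
  show "pderiv G = smult (fact k) T"
  proof (rule poly_eqI)
    fix l
    show "coeff (pderiv G) l = coeff (smult (fact k) T) l"
    proof (cases "l < k")
      case True
      then have "Suc l dvd fact k"
        by (intro dvd_fact) auto
      then have "int (Suc l) dvd int (fact k)"
        by (subst int_dvd_int_iff)
      then have "int (Suc l) dvd fact k" by simp
      then have "int (Suc l) * (fact k div int (Suc l)) = fact k"
        by (rule dvd_mult_div_cancel)
      then show ?thesis
        using True by (simp add: coeff_pderiv c del: of_nat_Suc)
    next
      case False
      then show ?thesis using assms
        by (simp add: coeff_pderiv c coeff_eq_0)
    qed
  qed
qed

text \<open>The hypothesis speaks only of powers occurring in \<open>Q\<close>; a \<open>Q\<close>
  without terms below degree \<open>t\<close> thus draws only on equations of degree at least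
  \<open>t\<close>.\<close>

lemma cong_power_sum_poly:
  fixes x y :: "'i \<Rightarrow> int"
  assumes "\<And>j. coeff Q j \<noteq> 0 \<Longrightarrow> [(\<Sum>i\<in>I. x i ^ j) = (\<Sum>i\<in>I. y i ^ j)] (mod q)"
  shows "[(\<Sum>i\<in>I. poly Q (x i)) = (\<Sum>i\<in>I. poly Q (y i))] (mod q)"
proof -
  have e: "(\<Sum>i\<in>I. poly Q (x i)) = (\<Sum>j\<le>degree Q. coeff Q j * (\<Sum>i\<in>I. x i ^ j))" for x :: "'i \<Rightarrow> int"
    by (simp add: poly_altdef sum_distrib_left sum.swap[of _ I])
  show ?thesis
    unfolding e by (intro cong_sum) (metis assms cong_mult cong_refl mult_zero_left)
qed

text \<open>Congruence modulo 0 is equality. With \<open>Q\<close> a power of a linear polynomial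
  this is the translation invariance of the system.\<close>

lemma power_sum_poly_eq:
  fixes x y :: "'i \<Rightarrow> int"
  assumes "\<And>j. j \<in> {1..k} \<Longrightarrow> (\<Sum>i\<in>I. x i ^ j) = (\<Sum>i\<in>I. y i ^ j)"
    and "degree Q \<le> k"
  shows "(\<Sum>i\<in>I. poly Q (x i)) = (\<Sum>i\<in>I. poly Q (y i))"
proof -
  have "[(\<Sum>i\<in>I. x i ^ j) = (\<Sum>i\<in>I. y i ^ j)] (mod 0)" if "coeff Q j \<noteq> 0" for j
    using assms(1)[of j] le_degree[OF that] assms(2) by (cases "j = 0") auto
  then show ?thesis
    using cong_power_sum_poly[where Q=Q and I=I and x=x and y=y and q=0] by simp
qed

text \<open>
  The step from \<open>f\<close> to \<open>Suc f\<close>: a polynomial in the span of \<open>u\<^sup>t, \<dots>, u\<^sup>k\<close> is chosen whose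
  derivative vanishes at every \<open>\<omega> + p\<^sup>a w\<^sub>i\<close> except \<open>i = i\<^sub>0\<close>, so that to first order only
  the term \<open>i\<^sub>0\<close> survives.
\<close>
lemma well_conditioned_cong:
  fixes p :: nat and \<omega> :: int and z w :: "'i \<Rightarrow> int"
  assumes p: "prime p" "k < p" and S: "finite S" "t + card S = Suc k" "1 \<le> t"
    and \<omega>: "\<not> int p dvd \<omega>" and a: "1 \<le> a"
    and zw: "\<And>i. i \<in> S \<Longrightarrow> [z i = w i] (mod int p)"
    and w: "\<And>i j. i \<in> S \<Longrightarrow> j \<in> S \<Longrightarrow> [w i = w j] (mod int p) \<Longrightarrow> i = j"
    and sums: "\<And>j. j \<in> {t..k} \<Longrightarrow>
      [(\<Sum>i\<in>S. (\<omega> + int p ^ a * z i) ^ j) = (\<Sum>i\<in>S. (\<omega> + int p ^ a * w i) ^ j)] (mod int p ^ e)"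
    and "i \<in> S" and f: "f + a * card S \<le> e"
  shows "[z i = w i] (mod int p ^ f)"
  using \<open>i \<in> S\<close> f
proof (induction f arbitrary: i)
  case 0
  then show ?case by simp
next
  case (Suc f i0)
  have P: "prime (int p)" using p by simp
  show ?case
  proof (cases "f = 0")
    case True
    then show ?thesis using zw Suc.prems by simp
  next
    case False
    have "\<exists>n. z i = w i + int p ^ f * n" if "i \<in> S" for i
      using Suc.IH[OF that] Suc.prems by (metis add_Suc cong_iff_lin cong_sym Suc_leD)
    then obtain n where n: "\<And>i. i \<in> S \<Longrightarrow> z i = w i + int p ^ f * n i" by metis
    \<comment> \<open>\<open>R\<close> vanishes at the competing \<open>w i\<close>,
      \<open>R'\<close> is its counterpart in the variable \<open>u = \<omega> + p^a x\<close>, and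
      \<open>L\<close> is this change of variable.\<close>
    define R where "R = (\<Prod>i\<in>S-{i0}. [:-w i, 1:])"
    define R' where "R' = (\<Prod>i\<in>S-{i0}. [:-(\<omega> + int p ^ a * w i), 1:])"
    define L where "L = [:\<omega>, int p ^ a:]"
    have deg: "card (S - {i0}) = card S - 1" "card S \<ge> 1"
      using Suc.prems S(1) by (auto simp: Suc_le_eq card_gt_0_iff)
    have degR: "degree R = card S - 1" "degree R' = card S - 1"
      unfolding R_def R'_def by (subst degree_prod_eq_sum_degree; simp add: deg)+
    have "degree (L ^ (t - 1)) \<le> degree L * (t - 1)"
      by (rule degree_power_le)
    also have "\<dots> \<le> 1 * (t - 1)"
      by (intro mult_right_mono) (auto simp: L_def)
    finally have "degree (L ^ (t - 1) * R) < k"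
      using degree_mult_le[of "L ^ (t - 1)" R] degR deg S by linarith
    then obtain G where G: "pderiv G = smult (fact k) (L ^ (t - 1) * R)"
      using exists_int_antiderivative by blast
    have "degree (monom 1 (t - 1) * R') < k"
      using degR deg S degree_mult_le[of "monom 1 (t - 1)" R']
      by (simp add: degree_monom_eq)
    then obtain Q where Q: "pderiv Q = smult (fact k) (monom 1 (t - 1) * R')" "coeff Q 0 = 0"
      "degree Q \<le> k" "\<And>l. coeff (monom 1 (t - 1) * R') l = 0 \<Longrightarrow> coeff Q (Suc l) = 0"
      using exists_int_antiderivative by blast
    \<comment> \<open>The factor \<open>u^(t - 1)\<close> in the derivative of \<open>Q\<close> and
      the zero constant term leave only exponents whose power sums are known to be
      congruent.\<close>
    have Qlow: "j \<in> {t..k}" if "coeff Q j \<noteq> 0" for j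
    proof -
      have "j \<noteq> 0" using Q(2) that by metis
      then obtain l where l: "j = Suc l" using not0_implies_Suc by blast
      have "\<not> l < t - 1"
        using Q(4)[of l] that l by (auto simp: coeff_monom_mult)
      then show ?thesis
        using le_degree[OF that] Q(3) l by auto
    qed
    \<comment> \<open>Each of the \<open>card S - 1\<close> factors of \<open>R'\<close> yields one
      \<open>p^a\<close>, and the chain rule supplies another. This is the loss
      \<open>a * card S\<close> in the hypothesis relating \<open>f\<close> and
      \<open>e\<close>.\<close>
    have "pcompose R' L = (\<Prod>i\<in>S-{i0}. smult (int p ^ a) [:-w i, 1:])"
      unfolding R'_def pcompose_prod
      by (intro prod.cong) (auto simp: L_def pcompose_pCons)
    also have "\<dots> = smult (int p ^ (a * (card S - 1))) R"
      by (subst prod_smult) (simp add: R_def deg power_mult)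
    finally have R'L: "pcompose R' L = smult (int p ^ (a * (card S - 1))) R" .
    have "pderiv (pcompose Q L) = smult (int p ^ (a * card S)) (pderiv G)"
    proof -
      have "pcompose (monom 1 n) L = L ^ n" for n
        by (induction n) (simp_all add: monom_0 monom_Suc pcompose_pCons pcompose_1 flip: one_pCons)
      moreover have "int p ^ a * int p ^ (a * (card S - 1)) = int p ^ (a * card S)"
        using deg by (metis le_add_diff_inverse mult.right_neutral distrib_left power_add)
      moreover have "pderiv L = [:int p ^ a:]"
        by (simp add: L_def pderiv_pCons)
      ultimately show ?thesis
        by (simp add: pderiv_pcompose Q(1) G pcompose_smult pcompose_mult R'L mult_ac)
    qed
    then have "pderiv (pcompose Q L - smult (int p ^ (a * card S)) G) = 0"
      by (simp add: pderiv_diff pderiv_smult)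
    then obtain c where c: "pcompose Q L - smult (int p ^ (a * card S)) G = [:c:]"
      using pderiv_iszero by blast
    have QG: "poly Q (\<omega> + int p ^ a * x) = c + int p ^ (a * card S) * poly G x" for x
      using arg_cong[OF c, of "\<lambda>q. poly q x"] by (simp add: poly_pcompose L_def algebra_simps)
    have "[(\<Sum>i\<in>S. poly Q (\<omega> + int p ^ a * z i)) = (\<Sum>i\<in>S. poly Q (\<omega> + int p ^ a * w i))]
      (mod int p ^ e)"
      by (rule cong_power_sum_poly) (use sums Qlow in blast)
    then have "int p ^ e dvd int p ^ (a * card S) * (\<Sum>i\<in>S. poly G (z i) - poly G (w i))"
      by (simp add: QG cong_iff_dvd_diff sum.distrib sum_subtractf right_diff_distrib flip: sum_distrib_left)
    moreover have "int p ^ (a * card S) * int p ^ Suc f dvd int p ^ e"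
      using Suc.prems(2) by (simp add: power_add[symmetric] le_imp_power_dvd add.commute del: power_Suc)
    ultimately have "int p ^ (a * card S) * int p ^ Suc f dvd
        int p ^ (a * card S) * (\<Sum>i\<in>S. poly G (z i) - poly G (w i))"
      by (rule dvd_trans[rotated])
    then have d1: "int p ^ Suc f dvd (\<Sum>i\<in>S. poly G (z i) - poly G (w i))"
      using P by (subst (asm) dvd_mult_cancel_left) auto
    \<comment> \<open>Since \<open>f \<ge> 1\<close>, the exponent \<open>2 f\<close> is at least
      \<open>f + 1\<close>, so second-order terms disappear modulo \<open>p^(f + 1)\<close>.\<close>
    have d2: "int p ^ Suc f dvd (\<Sum>i\<in>S. poly G (z i) - poly G (w i) - int p ^ f * n i * poly (pderiv G) (w i))"
    proof (rule dvd_sum)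
      fix i assume i: "i \<in> S"
      have "Suc f \<le> f * 2" using False by simp
      then have "int p ^ Suc f dvd (int p ^ f * n i)\<^sup>2"
        unfolding power_mult_distrib power_mult[symmetric] by (intro dvd_mult2 le_imp_power_dvd)
      then show "int p ^ Suc f dvd poly G (z i) - poly G (w i) - int p ^ f * n i * poly (pderiv G) (w i)"
        using poly_Taylor1_dvd[of "int p ^ f * n i" G "w i"] n[OF i] by (metis dvd_trans)
    qed
    have "poly (pderiv G) (w i) = 0" if "i \<in> S - {i0}" for i
      using that S by (auto simp: G R_def poly_prod)
    then have "(\<Sum>i\<in>S. int p ^ f * n i * poly (pderiv G) (w i)) = int p ^ f * n i0 * poly (pderiv G) (w i0)"
      using S Suc.prems by (subst sum.remove[of _ i0]) auto
    then have "int p ^ Suc f dvd int p ^ f * n i0 * poly (pderiv G) (w i0)"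
      using dvd_diff[OF d1 d2] by (simp add: sum_subtractf)
    then have "int p dvd n i0 * poly (pderiv G) (w i0)"
      using P by (simp add: mult.assoc)
    \<comment> \<open>The derivative is a product of \<open>fact k\<close>, a power of
      \<open>\<omega> + p^a w\<close> and differences of distinct residues, all prime to
      \<open>p\<close>.\<close>
    moreover have "\<not> int p dvd poly (pderiv G) (w i0)"
    proof -
      have "\<not> int p dvd fact k"
        using p by (metis not_less of_nat_dvd_iff of_nat_fact prime_dvd_fact_iff)
      moreover have "\<not> int p dvd \<omega> + w i0 * int p ^ a"
        using \<omega> a by (metis dvd_add_left_iff dvd_mult dvd_power not_one_le_zero zero_less_iff_neq_zero)
      moreover have "\<not> int p dvd w i0 - w i" if "i \<in> S - {i0}" for i
        using that w[of i0 i] Suc.prems by (auto simp: cong_iff_dvd_diff)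
      ultimately show ?thesis
        using P S
        by (auto simp: G R_def L_def poly_prod prime_dvd_mult_iff prime_dvd_prod_iff
          dest: prime_dvd_power[OF P])
    qed
    ultimately have "int p dvd n i0"
      using P by (simp add: prime_dvd_mult_iff)
    then have "int p ^ Suc f dvd z i0 - w i0"
      using n[OF Suc.prems(1)] by (simp add: mult.commute)
    then show ?thesis by (simp add: cong_iff_dvd_diff)
  qed
qed

subsection \<open>Hoelder's inequality and multilinear reduction\<close>

text \<open>Weighted arithmetic-geometric mean, from convexity of \<open>exp\<close>; zero arguments
  are treated apart because of the logarithm.\<close>

lemma powr_Young:
  fixes a b \<theta> :: real
  assumes "0 \<le> a" "0 \<le> b" "0 \<le> \<theta>" "\<theta> \<le> 1"
  shows "a powr \<theta> * b powr (1 - \<theta>) \<le> \<theta> * a + (1 - \<theta>) * b"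
proof (cases "a = 0 \<or> b = 0")
  case True
  then show ?thesis using assms by auto
next
  case False
  then have "0 < a" "0 < b" using assms by auto
  have "a powr \<theta> * b powr (1 - \<theta>) = exp (\<theta> * ln a + (1 - \<theta>) * ln b)"
    using False by (simp add: powr_def exp_add)
  also have "\<dots> \<le> \<theta> * exp (ln a) + (1 - \<theta>) * exp (ln b)"
    using convex_onD[OF exp_convex, of \<theta> "ln b" "ln a"] assms by (simp add: add.commute)
  finally show ?thesis using \<open>0 < a\<close> \<open>0 < b\<close> by simp
qed

text \<open>Both sums are normalised to 1 and Young's inequality is applied to each term. If one of
  the sums is 0, every summand on the left vanishes.\<close>

lemma Holder_sum:
  fixes u v :: "'a \<Rightarrow> real"
  assumes "\<And>x. x \<in> A \<Longrightarrow> 0 \<le> u x" "\<And>x. x \<in> A \<Longrightarrow> 0 \<le> v x" "0 < \<theta>" "\<theta> < 1"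
  shows "(\<Sum>x\<in>A. u x powr \<theta> * v x powr (1 - \<theta>)) \<le> (\<Sum>x\<in>A. u x) powr \<theta> * (\<Sum>x\<in>A. v x) powr (1 - \<theta>)"
proof (cases "finite A \<and> (\<Sum>x\<in>A. u x) \<noteq> 0 \<and> (\<Sum>x\<in>A. v x) \<noteq> 0")
  case False
  then consider "infinite A" | "finite A" "\<forall>x\<in>A. u x = 0" | "finite A" "\<forall>x\<in>A. v x = 0"
    using assms sum_nonneg_eq_0_iff[of A u] sum_nonneg_eq_0_iff[of A v] by blast
  then show ?thesis by cases auto
next
  case True
  define U V where "U = (\<Sum>x\<in>A. u x)" and "V = (\<Sum>x\<in>A. v x)"
  have pos: "0 < U" "0 < V"
    using True assms by (auto simp: U_def V_def less_le sum_nonneg)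
  have "(\<Sum>x\<in>A. u x powr \<theta> * v x powr (1 - \<theta>))
    = U powr \<theta> * V powr (1 - \<theta>) * (\<Sum>x\<in>A. (u x / U) powr \<theta> * (v x / V) powr (1 - \<theta>))"
    using pos assms by (simp add: sum_distrib_left powr_divide field_simps)
  also have "\<dots> \<le> U powr \<theta> * V powr (1 - \<theta>) * (\<Sum>x\<in>A. \<theta> * (u x / U) + (1 - \<theta>) * (v x / V))"
    using pos assms by (intro mult_left_mono sum_mono powr_Young) auto
  also have "(\<Sum>x\<in>A. \<theta> * (u x / U) + (1 - \<theta>) * (v x / V)) = \<theta> * (U / U) + (1 - \<theta>) * (V / V)"
    by (simp add: U_def V_def sum.distrib flip: sum_distrib_left sum_divide_distrib)
  finally show ?thesis using pos by (simp add: U_def V_def)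
qed

text \<open>Translates the real exponents of Hoelder's inequality into natural ones. The condition
  \<open>0 < n'\<close> takes care of the base 0, where \<open>0 powr 0 = 0\<close> but
  \<open>0 ^ 0 = 1\<close>.\<close>

lemma power_powr_eq_power:
  fixes x c :: real
  assumes "0 \<le> x" "0 < n'" "real n * c = real n'"
  shows "(x ^ n) powr c = x ^ n'"
proof (cases "x = 0")
  case True
  have "n \<noteq> 0" using assms by (intro notI) auto
  then show ?thesis using True assms by (auto simp: power_0_left)
next
  case False
  then show ?thesis using assms by (simp add: powr_powr flip: powr_realpow)
qed

text \<open>Hoelder's inequality against the constant 1, with weight \<open>1 / n\<close>.\<close>

lemma power_sum_le_sum_power:
  fixes z :: "'a \<Rightarrow> real"
  assumes "\<And>x. x \<in> A \<Longrightarrow> 0 \<le> z x" "1 \<le> n"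
  shows "(\<Sum>x\<in>A. z x) ^ n \<le> real (card A) ^ (n - 1) * (\<Sum>x\<in>A. z x ^ n)"
proof (cases "n = 1 \<or> infinite A \<or> A = {}")
  case True
  then show ?thesis using assms by (auto simp: power_0_left)
next
  case False
  then have n: "1 < n" and A: "finite A" "A \<noteq> {}" using assms by auto
  have "(\<Sum>x\<in>A. z x) = (\<Sum>x\<in>A. (z x ^ n) powr (1 / n) * 1 powr (1 - 1 / n))"
    using n assms by (intro sum.cong) (simp_all add: power_powr_eq_power[where n' = 1])
  also have "\<dots> \<le> (\<Sum>x\<in>A. z x ^ n) powr (1 / n) * (\<Sum>x\<in>A. 1) powr (1 - 1 / n)"
    using n assms by (intro Holder_sum) auto
  finally have "(\<Sum>x\<in>A. z x) ^ n \<le> ((\<Sum>x\<in>A. z x ^ n) powr (1 / n) * real (card A) powr (1 - 1 / n)) ^ n"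
    using assms by (intro power_mono sum_nonneg) auto
  also have "\<dots> = ((\<Sum>x\<in>A. z x ^ n) powr (1 / n)) ^ n * (real (card A) powr (1 - 1 / n)) ^ n"
    by (rule power_mult_distrib)
  also have "((\<Sum>x\<in>A. z x ^ n) powr (1 / n)) ^ n = (\<Sum>x\<in>A. z x ^ n)"
  proof -
    have "0 \<le> (\<Sum>x\<in>A. z x ^ n)" using assms by (simp add: sum_nonneg)
    then show ?thesis using n
      by (cases "(\<Sum>x\<in>A. z x ^ n) = 0") (simp_all add: powr_powr flip: powr_realpow)
  qed
  also have "(real (card A) powr (1 - 1 / n)) ^ n = real (card A) ^ (n - 1)"
  proof -
    have "real (card A) > 0" using A by (simp add: card_gt_0_iff)
    then have "(real (card A) powr (1 - 1 / n)) ^ n = real (card A) powr ((1 - 1 / n) * n)"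
      by (simp add: powr_powr flip: powr_realpow)
    also have "(1 - 1 / n) * n = real (n - 1)"
      using n by (simp add: field_simps of_nat_diff)
    finally show ?thesis using \<open>real (card A) > 0\<close> by (simp add: powr_realpow)
  qed
  finally show ?thesis by (simp add: mult.commute)
qed

text \<open>Let \<open>B\<close> collect the terms of size at least \<open>F / (2 P)\<close>. The
  terms outside \<open>B\<close> add up to at most \<open>F / 2\<close>. If \<open>B\<close> has
  fewer than \<open>r\<close> members and no term reaches \<open>F / (2 r)\<close>, then
  \<open>B\<close> contributes less than \<open>F / 2\<close>, contradicting the lower bound for the
  sum.\<close>

lemma broad_narrow:
  fixes z :: "'a \<Rightarrow> real"
  assumes "finite A" "A \<noteq> {}" "card A \<le> P" "\<And>c. c \<in> A \<Longrightarrow> 0 \<le> z c" "1 \<le> r"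
    and F: "0 \<le> F" "F \<le> (\<Sum>c\<in>A. z c)"
  obtains (narrow) c where "c \<in> A" "F \<le> 2 * real r * z c"
  | (broad) S where "S \<subseteq> A" "card S = r" "\<And>c. c \<in> S \<Longrightarrow> F \<le> 2 * real P * z c"
proof -
  define B where "B = {c\<in>A. F \<le> 2 * real P * z c}"
  have BA: "B \<subseteq> A" "finite B" using assms by (auto simp: B_def)
  have "0 < P" using assms by (metis card_gt_0_iff less_le_trans)
  show thesis
  proof (cases "r \<le> card B")
    case True
    then obtain S where "S \<subseteq> B" "card S = r" by (metis obtain_subset_with_card_n)
    then show thesis using broad[of S] BA by (auto simp: B_def)
  next
    case False
    have "\<exists>c\<in>A. F \<le> 2 * real r * z c"
    proof (rule ccontr)
      assume neg: "\<not> (\<exists>c\<in>A. F \<le> 2 * real r * z c)"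
      then have sm: "z c \<le> F / (2 * real r)" if "c \<in> A" for c
        using that assms(5) by (auto simp: field_simps dest!: bspec[where x = c])
      obtain c0 where c0: "c0 \<in> A" using assms by blast
      have "0 \<le> 2 * real r * z c0" using assms(4)[OF c0] by simp
      then have "F > 0" using neg c0 by force
      have "(\<Sum>c\<in>A-B. z c) \<le> real (card (A - B)) * (F / (2 * real P))"
        using \<open>0 < P\<close> by (intro sum_bounded_above) (auto simp: B_def field_simps)
      also have "\<dots> \<le> real P * (F / (2 * real P))"
        using assms BA F card_mono[of A "A - B"] by (intro mult_right_mono) auto
      also have "\<dots> = F / 2" using \<open>0 < P\<close> by simp
      finally have 1: "(\<Sum>c\<in>A-B. z c) \<le> F / 2" .
      have "(\<Sum>c\<in>B. z c) \<le> real (card B) * (F / (2 * real r))"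
        using sm BA by (intro sum_bounded_above) auto
      also have "\<dots> < real r * (F / (2 * real r))"
        using False \<open>F > 0\<close> assms(5) by (intro mult_strict_right_mono) auto
      also have "\<dots> = F / 2" using assms(5) by simp
      finally have "(\<Sum>c\<in>B. z c) < F / 2" .
      then show False
        using 1 F sum.subset_diff[OF BA(1) assms(1), of z] by linarith
    qed
    then show thesis using narrow by blast
  qed
qed

text \<open>The terms selected by the dichotomy will depend on the frequency at which it is applied;
  summing over all \<open>c\<close> and all \<open>S\<close> removes this dependence, so that the
  bound can be averaged. In the broad case only \<open>2 r\<close> of the \<open>n\<close> factors
  are expanded, the others being kept for Hoelder's inequality.\<close>

lemma multilinear_reduction:
  fixes z :: "'a \<Rightarrow> real"
  assumes "finite A" "A \<noteq> {}" "card A \<le> P" "\<And>c. c \<in> A \<Longrightarrow> 0 \<le> z c" "1 \<le> r"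
    and F: "0 \<le> F" "F \<le> (\<Sum>c\<in>A. z c)" and n: "2 * r \<le> n"
  shows "F ^ n \<le> (2 * real r) ^ n * (\<Sum>c\<in>A. z c ^ n)
    + (2 * real P) ^ (2 * r) * (\<Sum>S | S \<subseteq> A \<and> card S = r. (\<Prod>c\<in>S. (z c)\<^sup>2) * F ^ (n - 2 * r))"
proof -
  have nn: "0 \<le> (2 * real r) ^ n * (\<Sum>c\<in>A. z c ^ n)"
    using assms by (intro mult_nonneg_nonneg sum_nonneg) auto
  have nb: "0 \<le> (\<Prod>c\<in>S. (z c)\<^sup>2) * F ^ (n - 2 * r)" for S
    using F by (intro mult_nonneg_nonneg prod_nonneg) auto
  have nb': "0 \<le> (2 * real P) ^ (2 * r) * (\<Sum>S | S \<subseteq> A \<and> card S = r. (\<Prod>c\<in>S. (z c)\<^sup>2) * F ^ (n - 2 * r))"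
    by (rule mult_nonneg_nonneg[OF _ sum_nonneg[OF nb]]) simp
  show ?thesis
  proof (rule broad_narrow[OF assms(1-5) F])
    fix c assume c: "c \<in> A" "F \<le> 2 * real r * z c"
    then have "F ^ n \<le> (2 * real r * z c) ^ n" using F by (intro power_mono)
    also have "\<dots> \<le> (2 * real r) ^ n * (\<Sum>c\<in>A. z c ^ n)"
      unfolding power_mult_distrib using c assms by (intro mult_left_mono member_le_sum) auto
    finally show ?thesis using nb' by linarith
  next
    fix S assume S: "S \<subseteq> A" "card S = r" "\<And>c. c \<in> S \<Longrightarrow> F \<le> 2 * real P * z c"
    have "F ^ (2 * r) = (\<Prod>c\<in>S. F\<^sup>2)" using S by (simp add: power_mult)
    also have "\<dots> \<le> (\<Prod>c\<in>S. (2 * real P * z c)\<^sup>2)"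
      using S F by (intro prod_mono) (auto intro!: power_mono)
    also have "\<dots> = (2 * real P) ^ (2 * r) * (\<Prod>c\<in>S. (z c)\<^sup>2)"
      using S by (simp add: power_mult_distrib prod.distrib power_mult)
    finally have "F ^ (2 * r) * F ^ (n - 2 * r) \<le> (2 * real P) ^ (2 * r) * (\<Prod>c\<in>S. (z c)\<^sup>2) * F ^ (n - 2 * r)"
      using F by (intro mult_right_mono) auto
    moreover have "F ^ (2 * r) * F ^ (n - 2 * r) = F ^ n"
      using n by (simp flip: power_add)
    moreover have "(\<Prod>c\<in>S. (z c)\<^sup>2) * F ^ (n - 2 * r)
      \<le> (\<Sum>S | S \<subseteq> A \<and> card S = r. (\<Prod>c\<in>S. (z c)\<^sup>2) * F ^ (n - 2 * r))"
      using S assms(1) nb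
      by (intro member_le_sum[where f = "\<lambda>S. (\<Prod>c\<in>S. (z c)\<^sup>2) * F ^ (n - 2 * r)"]) auto
    then have "(2 * real P) ^ (2 * r) * ((\<Prod>c\<in>S. (z c)\<^sup>2) * F ^ (n - 2 * r))
      \<le> (2 * real P) ^ (2 * r) * (\<Sum>S | S \<subseteq> A \<and> card S = r. (\<Prod>c\<in>S. (z c)\<^sup>2) * F ^ (n - 2 * r))"
      by (intro mult_left_mono) auto
    ultimately show ?thesis using nn by (simp only: mult.assoc)
  qed
qed

text \<open>The dichotomy with \<open>r = 2\<close>, hence the constant \<open>4 = 2 * 2\<close>. In
  the broad case two distinct large terms share out the \<open>m + n\<close> factors.\<close>

lemma bilinear_reduction:
  fixes z :: "'a \<Rightarrow> real"
  assumes "finite A" "A \<noteq> {}" "card A \<le> P" "\<And>c. c \<in> A \<Longrightarrow> 0 \<le> z c"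
    and F: "0 \<le> F" "F \<le> (\<Sum>c\<in>A. z c)"
  shows "F ^ (m + n) \<le> 4 ^ (m + n) * (\<Sum>c\<in>A. z c ^ (m + n))
    + (2 * real P) ^ (m + n) * (\<Sum>c\<in>A. \<Sum>d\<in>A-{c}. z c ^ m * z d ^ n)"
proof -
  have nn: "0 \<le> (\<Sum>c\<in>A. z c ^ (m + n))"
    using assms by (intro sum_nonneg) auto
  have nb: "0 \<le> (\<Sum>d\<in>A-{c}. z c ^ m * z d ^ n)" if "c \<in> A" for c
    using assms that by (intro mult_nonneg_nonneg sum_nonneg) auto
  show ?thesis
  proof (rule broad_narrow[OF assms(1-4) _ F, of 2])
    fix c assume c: "c \<in> A" "F \<le> 2 * real 2 * z c"
    then have "F ^ (m + n) \<le> (2 * real 2 * z c) ^ (m + n)" using F by (intro power_mono)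
    also have "\<dots> \<le> (2 * real 2) ^ (m + n) * (\<Sum>c\<in>A. z c ^ (m + n))"
      unfolding power_mult_distrib using c assms by (intro mult_left_mono member_le_sum) auto
    finally have "F ^ (m + n) \<le> 4 ^ (m + n) * (\<Sum>c\<in>A. z c ^ (m + n))" by simp
    moreover have "0 \<le> (2 * real P) ^ (m + n) * (\<Sum>c\<in>A. \<Sum>d\<in>A-{c}. z c ^ m * z d ^ n)"
      by (rule mult_nonneg_nonneg[OF _ sum_nonneg[OF nb]]) auto
    ultimately show ?thesis by linarith
  next
    fix S assume S: "S \<subseteq> A" "card S = 2" "\<And>c. c \<in> S \<Longrightarrow> F \<le> 2 * real P * z c"
    then obtain c d where cd: "S = {c, d}" "c \<noteq> d" by (auto simp: card_2_iff)
    have "F ^ (m + n) \<le> (2 * real P * z c) ^ m * (2 * real P * z d) ^ n"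
      unfolding power_add using F S cd assms(4)
      by (intro mult_mono power_mono) auto
    also have "\<dots> = (2 * real P) ^ (m + n) * (z c ^ m * z d ^ n)"
      by (simp add: power_add power_mult_distrib)
    also have "z c ^ m * z d ^ n \<le> (\<Sum>d\<in>A-{c}. z c ^ m * z d ^ n)"
      using assms S cd by (intro member_le_sum[where f = "\<lambda>d. z c ^ m * z d ^ n"]) auto
    also have "\<dots> \<le> (\<Sum>c\<in>A. \<Sum>d\<in>A-{c}. z c ^ m * z d ^ n)"
      using assms S cd nb by (intro member_le_sum[where f = "\<lambda>c. \<Sum>d\<in>A-{c}. z c ^ m * z d ^ n"]) auto
    finally show ?thesis
      using nn by (smt (verit) mult_left_mono mult_nonneg_nonneg of_nat_0_le_iff zero_le_power)
  qed auto
qed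

section \<open>Monotonicity, linearity and Hoelder's inequality for mean values\<close>

lemma mean_mono:
  fixes F G :: "(nat \<Rightarrow> nat) \<Rightarrow> real"
  assumes "\<And>\<alpha>. F \<alpha> \<le> G \<alpha>"
  shows "mean k N F \<le> mean k N G"
  unfolding mean_def by (intro divide_right_mono sum_mono assms) auto

lemma mean_nonneg:
  fixes F :: "(nat \<Rightarrow> nat) \<Rightarrow> real"
  assumes "\<And>\<alpha>. 0 \<le> F \<alpha>"
  shows "0 \<le> mean k N F"
  unfolding mean_def by (intro divide_nonneg_nonneg sum_nonneg assms) auto

lemma mean_add: "mean k N (\<lambda>\<alpha>. F \<alpha> + G \<alpha>) = mean k N F + mean k N G"
  by (simp add: mean_def sum.distrib add_divide_distrib)

lemma mean_cmult: "mean k N (\<lambda>\<alpha>. c * F \<alpha>) = c * mean k N F"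
  by (simp add: mean_def sum_distrib_left)

lemma mean_Holder:
  fixes u v :: "(nat \<Rightarrow> nat) \<Rightarrow> real"
  assumes "\<And>\<alpha>. 0 \<le> u \<alpha>" "\<And>\<alpha>. 0 \<le> v \<alpha>" "0 < \<theta>" "\<theta> < 1"
  shows "mean k N (\<lambda>\<alpha>. u \<alpha> powr \<theta> * v \<alpha> powr (1 - \<theta>)) \<le> mean k N u powr \<theta> * mean k N v powr (1 - \<theta>)"
proof -
  define n where "n = real (N ^ k)"
  have "n \<ge> 0" by (simp add: n_def)
  then have n: "n powr \<theta> * n powr (1 - \<theta>) = n"
    using powr_add[of n \<theta> "1 - \<theta>"] by simp
  have mean_n: "mean k N F = (\<Sum>\<alpha>\<in>{1..k} \<rightarrow>\<^sub>E {..<N}. F \<alpha>) / n" for F :: "(nat \<Rightarrow> nat) \<Rightarrow> real"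
    by (simp add: mean_def n_def)
  have "mean k N u powr \<theta> * mean k N v powr (1 - \<theta>)
    = ((\<Sum>\<alpha>\<in>{1..k} \<rightarrow>\<^sub>E {..<N}. u \<alpha>) powr \<theta> * (\<Sum>\<alpha>\<in>{1..k} \<rightarrow>\<^sub>E {..<N}. v \<alpha>) powr (1 - \<theta>)) / n"
    unfolding mean_n using assms \<open>n \<ge> 0\<close> n by (simp add: powr_divide sum_nonneg)
  moreover have "mean k N (\<lambda>\<alpha>. u \<alpha> powr \<theta> * v \<alpha> powr (1 - \<theta>))
    \<le> ((\<Sum>\<alpha>\<in>{1..k} \<rightarrow>\<^sub>E {..<N}. u \<alpha>) powr \<theta> * (\<Sum>\<alpha>\<in>{1..k} \<rightarrow>\<^sub>E {..<N}. v \<alpha>) powr (1 - \<theta>)) / n"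
    unfolding mean_n using assms \<open>n \<ge> 0\<close> by (intro divide_right_mono Holder_sum) auto
  ultimately show ?thesis by (simp only:)
qed

text \<open>The largest factor dominates. Applied to squares, this decouples a product over
  \<open>r\<close> classes into \<open>2 r\<close>-th powers of single sums.\<close>

lemma prod_le_sum_power:
  fixes y :: "'a \<Rightarrow> real"
  assumes "finite S" "S \<noteq> {}" "\<And>c. c \<in> S \<Longrightarrow> 0 \<le> y c"
  shows "(\<Prod>c\<in>S. y c) \<le> (\<Sum>c\<in>S. y c ^ card S)"
proof -
  have "Max (y ` S) \<in> y ` S" using assms by (intro Max_in) auto
  then obtain c0 where "c0 \<in> S" "Max (y ` S) = y c0" by blast
  then have c0: "c0 \<in> S" "\<And>c. c \<in> S \<Longrightarrow> y c \<le> y c0"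
    using assms by (auto simp flip: \<open>Max (y ` S) = y c0\<close>)
  have "(\<Prod>c\<in>S. y c) \<le> (\<Prod>c\<in>S. y c0)" using c0 assms by (intro prod_mono) auto
  also have "\<dots> = y c0 ^ card S" by simp
  also have "\<dots> \<le> (\<Sum>c\<in>S. y c ^ card S)"
    using assms c0 by (intro member_le_sum[where f = "\<lambda>c. y c ^ card S"]) auto
  finally show ?thesis .
qed

subsection \<open>Exponential sums over residue classes\<close>

lemma finite_power_sum_solutions:
  assumes "finite I" "\<And>i. i \<in> I \<Longrightarrow> finite (X i)"
  shows "finite (power_sum_solutions k I X)"
proof (rule finite_subset)
  show "power_sum_solutions k I X \<subseteq> Pi\<^sub>E I X \<times> Pi\<^sub>E I X"
    by (auto simp: power_sum_solutions_def)
  show "finite (Pi\<^sub>E I X \<times> Pi\<^sub>E I X)"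
    using assms by (intro finite_cartesian_product finite_PiE) auto
qed

definition vino_count :: "nat \<Rightarrow> nat \<Rightarrow> nat \<Rightarrow> nat" where
  "vino_count s k L = card (power_sum_solutions k {1..s} (\<lambda>_. {0..<int L}))"

lemma cong_refine:
  fixes x \<xi> :: int
  assumes "a \<le> c" "[x = \<xi>] (mod int p ^ a)" "0 < p"
  obtains h where "h < p ^ (c - a)" "[x = \<xi> + int p ^ a * int h] (mod int p ^ c)"
proof -
  obtain y where y: "x = \<xi> + int p ^ a * y"
    using assms by (metis cong_iff_lin cong_sym)
  define h where "h = nat (y mod int p ^ (c - a))"
  have q: "0 < int p ^ (c - a)" using assms by simp
  have h: "int h = y mod int p ^ (c - a)"
    using q by (simp add: h_def)
  then have "h < p ^ (c - a)"
    using q by (metis of_nat_less_iff of_nat_power pos_mod_bound)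
  moreover have "[y = int h] (mod int p ^ (c - a))"
    by (simp add: h cong_sym)
  then have "int p ^ a * int p ^ (c - a) dvd int p ^ a * (y - int h)"
    by (simp add: cong_iff_dvd_diff)
  then have "[x = \<xi> + int p ^ a * int h] (mod int p ^ c)"
    using assms(1) by (simp add: y cong_iff_dvd_diff right_diff_distrib flip: power_add)
  ultimately show thesis by (rule that)
qed

text \<open>The size of \<open>N\<close> ensures that products of at most \<open>s\<close> squared
  sums over subsets of \<open>[0, p^M)\<close> have an exact solution count as their mean.\<close>

locale char_mean =
  fixes k p M N s :: nat
  assumes p: "prime p" and N: "s * (p ^ M) ^ k < N"
begin

definition cls :: "nat \<Rightarrow> int \<Rightarrow> int set" where
  "cls a \<xi> = {x \<in> {0..<int (p ^ M)}. [x = \<xi>] (mod int p ^ a)}"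

definition g :: "nat \<Rightarrow> int \<Rightarrow> (nat \<Rightarrow> nat) \<Rightarrow> real" where
  "g a \<xi> \<alpha> = norm (char_sum k N \<alpha> (cls a \<xi>))"

lemma g_nonneg [simp]: "0 \<le> g a \<xi> \<alpha>"
  by (simp add: g_def)

lemma p_gt_0 [simp]: "0 < p"
  using p prime_gt_0_nat by blast

lemma cls_subset: "cls a \<xi> \<subseteq> {0..<int (p ^ M)}"
  by (auto simp: cls_def)

lemma finite_cls [simp]: "finite (cls a \<xi>)"
  using cls_subset by (rule finite_subset) simp

lemma cls_0: "cls 0 \<xi> = {0..<int (p ^ M)}"
  by (auto simp: cls_def)

lemma cls_refine:
  assumes "a \<le> c"
  shows "cls a \<xi> = (\<Union>h<p ^ (c - a). cls c (\<xi> + int p ^ a * int h))"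
proof (intro equalityI subsetI)
  fix x assume "x \<in> cls a \<xi>"
  then show "x \<in> (\<Union>h<p ^ (c - a). cls c (\<xi> + int p ^ a * int h))"
    using cong_refine[OF assms, of x \<xi> p] by (auto simp: cls_def)
next
  fix x assume "x \<in> (\<Union>h<p ^ (c - a). cls c (\<xi> + int p ^ a * int h))"
  then obtain h where "x \<in> {0..<int (p ^ M)}" "[x = \<xi> + int p ^ a * int h] (mod int p ^ c)"
    by (auto simp: cls_def)
  moreover from this(2) have "[x = \<xi> + int p ^ a * int h] (mod int p ^ a)"
    using assms by (metis cong_dvd_modulus le_imp_power_dvd)
  then have "[x = \<xi>] (mod int p ^ a)"
    by (rule cong_trans) (simp add: cong_iff_dvd_diff)
  ultimately show "x \<in> cls a \<xi>" by (simp add: cls_def)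
qed

lemma g_le_sum:
  assumes "a \<le> c"
  shows "g a \<xi> \<alpha> \<le> (\<Sum>h<p ^ (c - a). g c (\<xi> + int p ^ a * int h) \<alpha>)"
proof -
  have "cls c (\<xi> + int p ^ a * int h) \<inter> cls c (\<xi> + int p ^ a * int h') = {}"
    if "h < p ^ (c - a)" "h' < p ^ (c - a)" "h \<noteq> h'" for h h'
  proof (rule ccontr)
    assume "\<not> ?thesis"
    then have "[\<xi> + int p ^ a * int h = \<xi> + int p ^ a * int h'] (mod int p ^ c)"
      by (auto simp: cls_def) (metis cong_sym cong_trans)
    then have "int p ^ a * int p ^ (c - a) dvd int p ^ a * (int h - int h')"
      using assms by (simp add: cong_iff_dvd_diff right_diff_distrib flip: power_add)
    then have "[int h = int h'] (mod int (p ^ (c - a)))"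
      using p_gt_0 by (simp add: cong_iff_dvd_diff)
    then have "[h = h'] (mod p ^ (c - a))"
      by (simp only: cong_int_iff)
    then show False using that by (simp add: cong_less_modulus_unique_nat)
  qed
  then have "char_sum k N \<alpha> (cls a \<xi>) = (\<Sum>h<p ^ (c - a). char_sum k N \<alpha> (cls c (\<xi> + int p ^ a * int h)))"
    unfolding cls_refine[OF assms, of \<xi>] char_sum_def by (intro sum.UNION_disjoint) auto
  then show ?thesis unfolding g_def by (simp add: sum_norm_le)
qed

lemma mean_prod_g:
  assumes "finite I" "card I \<le> s"
  shows "mean k N (\<lambda>\<alpha>. \<Prod>i\<in>I. (g (a i) (\<xi> i) \<alpha>)\<^sup>2)
    = real (card (power_sum_solutions k I (\<lambda>i. cls (a i) (\<xi> i))))"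
  unfolding g_def
proof (rule mean_norm_char_sum[where L = "p ^ M"])
  have "card I * (p ^ M) ^ k \<le> s * (p ^ M) ^ k"
    using assms(2) by (rule mult_le_mono1)
  then show "card I * (p ^ M) ^ k < N" using N by (rule le_less_trans)
  show "cls (a i) (\<xi> i) \<subseteq> {0..<int (p ^ M)}" for i by (rule cls_subset)
  show "0 < N" using N by (rule le_less_trans[OF le0])
  show "0 < p ^ M" by simp
qed (rule assms)

lemma mean_g_0:
  assumes "s' \<le> s"
  shows "mean k N (\<lambda>\<alpha>. g 0 \<xi> \<alpha> ^ (2 * s')) = real (vino_count s' k (p ^ M))"
  using mean_prod_g[of "{1..s'}" "\<lambda>_. 0" "\<lambda>_. \<xi>"] assms
  by (simp add: vino_count_def cls_0 power_mult)

text \<open>Translation and dilation invariance: with \<open>x = \<rho> + q y\<close>, where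
  \<open>\<rho>\<close> is the residue of \<open>\<xi>\<close>, the equations for
  \<open>(x - \<rho>)^j\<close> become those for \<open>y\<close> after cancelling
  \<open>q^j\<close>, and \<open>y\<close> lies in \<open>[0, p^(M - a))\<close>.\<close>

lemma mean_g_le:
  assumes "a \<le> M"
  shows "mean k N (\<lambda>\<alpha>. g a \<xi> \<alpha> ^ (2 * s)) \<le> real (vino_count s k (p ^ (M - a)))"
proof -
  let ?X = "\<lambda>i::nat. cls a \<xi>" and ?Y = "\<lambda>i::nat. {0..<int (p ^ (M - a))}"
  define q where "q = int p ^ a"
  define \<rho> where "\<rho> = \<xi> mod q"
  define D where "D x = restrict (\<lambda>i. x i div q) {1..s}" for x :: "nat \<Rightarrow> int"
  have q: "0 < q" by (simp add: q_def)
  have qM: "q * int (p ^ (M - a)) = int (p ^ M)"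
    using assms by (simp add: q_def flip: power_add)
  have el: "x = \<rho> + q * (x div q) \<and> x div q \<in> {0..<int (p ^ (M - a))}" if "x \<in> cls a \<xi>" for x
  proof -
    have "x mod q = \<rho>" using that by (simp add: cls_def \<rho>_def q_def cong_def)
    then have "x = \<rho> + q * (x div q)" by (metis add.commute mult_div_mod_eq)
    moreover have "0 \<le> x" "x < q * int (p ^ (M - a))" using that qM by (auto simp: cls_def)
    moreover have "x div q < int (p ^ (M - a))"
    proof (rule ccontr)
      assume "\<not> ?thesis"
      then have "q * int (p ^ (M - a)) \<le> q * (x div q)"
        using q by (intro mult_left_mono) auto
      also have "\<dots> \<le> x"
        using q by (simp add: minus_mod_eq_mult_div[symmetric])
      finally show False using \<open>x < q * int (p ^ (M - a))\<close> by simp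
    qed
    ultimately show ?thesis using q by (simp add: pos_imp_zdiv_nonneg_iff)
  qed
  have inj: "x = x'" if "x \<in> {1..s} \<rightarrow>\<^sub>E cls a \<xi>" "x' \<in> {1..s} \<rightarrow>\<^sub>E cls a \<xi>" "D x = D x'" for x x'
  proof (rule PiE_ext[OF that(1,2)])
    fix i assume i: "i \<in> {1..s}"
    then have "x i div q = x' i div q" using that(3) by (metis D_def restrict_apply')
    then show "x i = x' i" using el[OF PiE_mem[OF that(1) i]] el[OF PiE_mem[OF that(2) i]] by metis
  qed
  have "card (power_sum_solutions k {1..s} ?X) \<le> card (power_sum_solutions k {1..s} ?Y)"
  proof (rule card_inj_on_le[where f = "map_prod D D"])
    show "inj_on (map_prod D D) (power_sum_solutions k {1..s} ?X)"
    proof (rule inj_on_subset)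
      have "inj_on D ({1..s} \<rightarrow>\<^sub>E cls a \<xi>)" by (rule inj_onI) (rule inj)
      then show "inj_on (map_prod D D) (({1..s} \<rightarrow>\<^sub>E cls a \<xi>) \<times> ({1..s} \<rightarrow>\<^sub>E cls a \<xi>))"
        by (intro map_prod_inj_on)
    qed (auto simp: power_sum_solutions_def)
    show "finite (power_sum_solutions k {1..s} ?Y)"
      by (rule finite_power_sum_solutions) auto
    show "map_prod D D ` power_sum_solutions k {1..s} ?X \<subseteq> power_sum_solutions k {1..s} ?Y"
    proof (rule image_subsetI)
      fix xy assume "xy \<in> power_sum_solutions k {1..s} ?X"
      then obtain x y where xy_def: "xy = (x, y)" and xy: "(x, y) \<in> power_sum_solutions k {1..s} ?X"
        by (cases xy) auto
      then have x: "x \<in> {1..s} \<rightarrow>\<^sub>E cls a \<xi>" and y: "y \<in> {1..s} \<rightarrow>\<^sub>E cls a \<xi>"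
        by (auto simp: power_sum_solutions_def)
      have "(\<Sum>i=1..s. D x i ^ j) = (\<Sum>i=1..s. D y i ^ j)" if j: "j \<in> {1..k}" for j
      proof -
        have e: "poly ([:-\<rho>, 1:] ^ j) (x i) = q ^ j * D x i ^ j"
          if "x \<in> {1..s} \<rightarrow>\<^sub>E cls a \<xi>" "i \<in> {1..s}" for x i
        proof -
          have "x i - \<rho> = q * D x i"
            using el[OF PiE_mem[OF that]] that(2) by (simp add: D_def)
          then show ?thesis by (simp add: power_mult_distrib)
        qed
        have "(\<Sum>i=1..s. poly ([:-\<rho>, 1:] ^ j) (x i)) = (\<Sum>i=1..s. poly ([:-\<rho>, 1:] ^ j) (y i))"
        proof (rule power_sum_poly_eq)
          show "degree ([:-\<rho>, 1:] ^ j) \<le> k" using j by (simp add: degree_power_eq)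
        qed (use xy in \<open>auto simp: power_sum_solutions_def\<close>)
        moreover have "(\<Sum>i=1..s. poly ([:-\<rho>, 1:] ^ j) (x i)) = q ^ j * (\<Sum>i=1..s. D x i ^ j)"
          if "x \<in> {1..s} \<rightarrow>\<^sub>E cls a \<xi>" for x
          unfolding sum_distrib_left by (rule sum.cong[OF refl e[OF that]])
        ultimately have "q ^ j * (\<Sum>i=1..s. D x i ^ j) = q ^ j * (\<Sum>i=1..s. D y i ^ j)"
          using x y by metis
        then show ?thesis using q by simp
      qed
      moreover have "D x \<in> {1..s} \<rightarrow>\<^sub>E {0..<int (p ^ (M - a))}" if "x \<in> {1..s} \<rightarrow>\<^sub>E cls a \<xi>" for x
        using el[OF PiE_mem[OF that]] by (auto simp: D_def)
      ultimately show "map_prod D D xy \<in> power_sum_solutions k {1..s} ?Y"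
        using x y unfolding xy_def by (auto simp: power_sum_solutions_def)
    qed
  qed
  then show ?thesis
    using mean_prod_g[of "{1..s}" "\<lambda>_. a" "\<lambda>_. \<xi>"] by (simp add: vino_count_def power_mult)
qed

text \<open>After translation by \<open>\<eta>\<close>, the \<open>m\<close> variables congruent to
  \<open>\<eta>\<close> modulo \<open>p^b\<close> contribute multiples of \<open>p^(t b)\<close> to
  every equation of degree at least \<open>t\<close>. The other variables become
  \<open>\<xi> - \<eta> + p^a z\<close> with \<open>\<xi> - \<eta>\<close> prime to \<open>p\<close>
  and the \<open>z\<close> distinct modulo \<open>p\<close>, so \<open>well_conditioned_cong\<close>
  forces \<open>x\<close> and \<open>y\<close> into the same classes modulo \<open>p^B\<close>; the
  sum over \<open>\<theta>\<close> runs through these classes.\<close>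

lemma congruencing:
  assumes S: "S \<subseteq> {..<p}" "t + card S = Suc k" "1 \<le> t" "card S + m \<le> s" and "k < p"
    and a: "1 \<le> a" and \<xi>\<eta>: "\<not> [\<xi> = \<eta>] (mod int p)"
    and B: "a < B" "B + a * card S \<le> t * b + a"
  shows "mean k N (\<lambda>\<alpha>. (\<Prod>c\<in>S. (g (Suc a) (\<xi> + int p ^ a * int c) \<alpha>)\<^sup>2) * g b \<eta> \<alpha> ^ (2 * m))
    \<le> (\<Sum>\<theta>\<in>S \<rightarrow>\<^sub>E {..<p ^ (B - Suc a)}. mean k N (\<lambda>\<alpha>.
        (\<Prod>c\<in>S. (g B (\<xi> + int p ^ a * int c + int p ^ Suc a * int (\<theta> c)) \<alpha>)\<^sup>2) * g b \<eta> \<alpha> ^ (2 * m)))"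
proof -
  \<comment> \<open>\<open>Inl c\<close> indexes the single variable in the class of
    \<open>c\<close>, and \<open>Inr i\<close> the \<open>m\<close> variables in the class of
    \<open>\<eta>\<close>.\<close>
  define I :: "(nat + nat) set" where "I = S <+> {..<m}"
  define X where "X i = cls (case_sum (\<lambda>_. Suc a) (\<lambda>_. b) i) (case_sum (\<lambda>c. \<xi> + int p ^ a * int c) (\<lambda>_. \<eta>) i)"
    for i :: "nat + nat"
  define Y where "Y \<theta> i = cls (case_sum (\<lambda>_. B) (\<lambda>_. b) i)
      (case_sum (\<lambda>c. \<xi> + int p ^ a * int c + int p ^ Suc a * int (\<theta> c)) (\<lambda>_. \<eta>) i)"
    for \<theta> :: "nat \<Rightarrow> nat" and i :: "nat + nat"
  have InlI_I: "Inl c \<in> I" if "c \<in> S" for c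
    unfolding I_def using that by (rule InlI)
  have finS: "finite S" using S(1) finite_subset by blast
  have I: "finite I" "card I \<le> s" using finS S by (auto simp: I_def card_Plus)
  have mX: "mean k N (\<lambda>\<alpha>. (\<Prod>c\<in>S. (g (Suc a) (\<xi> + int p ^ a * int c) \<alpha>)\<^sup>2) * g b \<eta> \<alpha> ^ (2 * m))
    = real (card (power_sum_solutions k I X))"
    unfolding X_def mean_prod_g[OF I, symmetric] by (simp add: I_def prod.Plus finS o_def power_mult)
  have mY: "mean k N (\<lambda>\<alpha>. (\<Prod>c\<in>S. (g B (\<xi> + int p ^ a * int c + int p ^ Suc a * int (\<theta> c)) \<alpha>)\<^sup>2) * g b \<eta> \<alpha> ^ (2 * m))
    = real (card (power_sum_solutions k I (Y \<theta>)))" for \<theta>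
    unfolding Y_def mean_prod_g[OF I, symmetric] by (simp add: I_def prod.Plus finS o_def power_mult)
  define T where "T = S \<rightarrow>\<^sub>E {..<p ^ (B - Suc a)}"
  have "power_sum_solutions k I X \<subseteq> (\<Union>\<theta>\<in>T. power_sum_solutions k I (Y \<theta>))"
  proof clarify
    fix x y assume xy: "(x, y) \<in> power_sum_solutions k I X"
    have el: "\<exists>z. x (Inl c) = \<xi> + int p ^ a * z \<and> [z = int c] (mod int p)"
      if "x \<in> Pi\<^sub>E I X" "c \<in> S" for x c
    proof -
      have "[x (Inl c) = \<xi> + int p ^ a * int c] (mod int p ^ Suc a)"
        using PiE_mem[OF that(1) InlI_I[OF that(2)]] by (simp add: X_def cls_def)
      then obtain h where "x (Inl c) = \<xi> + int p ^ a * int c + int p ^ Suc a * h"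
        by (metis cong_iff_lin cong_sym)
      then have "x (Inl c) = \<xi> + int p ^ a * (int c + int p * h)"
        by (simp add: algebra_simps)
      moreover have "[int c + int p * h = int c] (mod int p)"
        by (simp add: cong_def)
      ultimately show ?thesis by blast
    qed
    have x: "x \<in> Pi\<^sub>E I X" and y: "y \<in> Pi\<^sub>E I X"
      and xy_eq: "\<And>j. j \<in> {1..k} \<Longrightarrow> (\<Sum>i\<in>I. x i ^ j) = (\<Sum>i\<in>I. y i ^ j)"
      using xy by (auto simp: power_sum_solutions_def)
    obtain z where z: "\<And>c. c \<in> S \<Longrightarrow> x (Inl c) = \<xi> + int p ^ a * z c"
      "\<And>c. c \<in> S \<Longrightarrow> [z c = int c] (mod int p)"
      using el[OF x] by metis
    obtain w where w: "\<And>c. c \<in> S \<Longrightarrow> y (Inl c) = \<xi> + int p ^ a * w c"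
      "\<And>c. c \<in> S \<Longrightarrow> [w c = int c] (mod int p)"
      using el[OF y] by metis
    have agree: "[x (Inl c) = y (Inl c)] (mod int p ^ B)" if "c \<in> S" for c
    proof -
      \<comment> \<open>\<open>z\<close> and \<open>w\<close> are coordinates after division by
        \<open>p^a\<close>, so agreement modulo \<open>p^(B - a)\<close> suffices.\<close>
      have "[z c = w c] (mod int p ^ (B - a))"
      proof (rule well_conditioned_cong[OF p \<open>k < p\<close> finS S(2,3) _ a, where e = "t * b" and i = c and \<omega> = "\<xi> - \<eta>"])
        show "\<not> int p dvd \<xi> - \<eta>" using \<xi>\<eta> by (simp add: cong_iff_dvd_diff)
        show "[z c = w c] (mod int p)" if "c \<in> S" for c
          using z(2)[OF that] w(2)[OF that] by (metis cong_sym cong_trans)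
        show "i = j" if "i \<in> S" "j \<in> S" "[w i = w j] (mod int p)" for i j
        proof -
          have "[int i = int j] (mod int p)"
            using w(2)[OF that(1)] w(2)[OF that(2)] that(3) by (metis cong_sym cong_trans)
          then show ?thesis
            using that S(1) by (auto simp: cong_int_iff intro: cong_less_modulus_unique_nat)
        qed
        show "B - a + a * card S \<le> t * b" using B by linarith
        show "[(\<Sum>i\<in>S. (\<xi> - \<eta> + int p ^ a * z i) ^ j) = (\<Sum>i\<in>S. (\<xi> - \<eta> + int p ^ a * w i) ^ j)] (mod int p ^ (t * b))"
          if j: "j \<in> {t..k}" for j
        proof -
          have "(\<Sum>i\<in>I. poly ([:-\<eta>, 1:] ^ j) (x i)) = (\<Sum>i\<in>I. poly ([:-\<eta>, 1:] ^ j) (y i))"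
            by (rule power_sum_poly_eq[OF xy_eq]) (use j in \<open>auto simp: degree_power_eq\<close>)
          then have e: "(\<Sum>c\<in>S. (x (Inl c) - \<eta>) ^ j) + (\<Sum>i<m. (x (Inr i) - \<eta>) ^ j)
            = (\<Sum>c\<in>S. (y (Inl c) - \<eta>) ^ j) + (\<Sum>i<m. (y (Inr i) - \<eta>) ^ j)"
            by (simp add: I_def sum.Plus finS o_def)
          have d: "int p ^ (t * b) dvd (\<Sum>i<m. (x (Inr i) - \<eta>) ^ j)" if "x \<in> Pi\<^sub>E I X" for x
          proof (rule dvd_sum)
            fix i assume "i \<in> {..<m}"
            then have "int p ^ b dvd x (Inr i) - \<eta>"
              using PiE_mem[OF that, of "Inr i"] by (auto simp: I_def X_def cls_def cong_iff_dvd_diff)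
            then have "(int p ^ b) ^ j dvd (x (Inr i) - \<eta>) ^ j" by (rule dvd_power_same)
            moreover have "int p ^ (t * b) dvd (int p ^ b) ^ j"
              using j by (simp add: le_imp_power_dvd mult.commute flip: power_mult)
            ultimately show "int p ^ (t * b) dvd (x (Inr i) - \<eta>) ^ j" by (rule dvd_trans[rotated])
          qed
          have "int p ^ (t * b) dvd (\<Sum>c\<in>S. (x (Inl c) - \<eta>) ^ j) - (\<Sum>c\<in>S. (y (Inl c) - \<eta>) ^ j)"
          proof -
            have "(\<Sum>c\<in>S. (x (Inl c) - \<eta>) ^ j) - (\<Sum>c\<in>S. (y (Inl c) - \<eta>) ^ j)
              = (\<Sum>i<m. (y (Inr i) - \<eta>) ^ j) - (\<Sum>i<m. (x (Inr i) - \<eta>) ^ j)"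
              using e by linarith
            then show ?thesis using dvd_diff[OF d[OF y] d[OF x]] by simp
          qed
          moreover have "(\<Sum>c\<in>S. (x (Inl c) - \<eta>) ^ j) = (\<Sum>c\<in>S. (\<xi> - \<eta> + int p ^ a * z c) ^ j)"
            by (intro sum.cong refl) (simp add: z(1) algebra_simps)
          moreover have "(\<Sum>c\<in>S. (y (Inl c) - \<eta>) ^ j) = (\<Sum>c\<in>S. (\<xi> - \<eta> + int p ^ a * w c) ^ j)"
            by (intro sum.cong refl) (simp add: w(1) algebra_simps)
          ultimately show ?thesis by (simp add: cong_iff_dvd_diff)
        qed
      qed (rule that)
      then have "int p ^ a * int p ^ (B - a) dvd int p ^ a * (z c - w c)"
        by (intro mult_dvd_mono) (simp_all add: cong_iff_dvd_diff)
      then show ?thesis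
        using B z(1)[OF that] w(1)[OF that]
        by (simp add: cong_iff_dvd_diff right_diff_distrib flip: power_add)
    qed
    have "\<exists>h<p ^ (B - Suc a). [x (Inl c) = \<xi> + int p ^ a * int c + int p ^ Suc a * int h] (mod int p ^ B)"
      if "c \<in> S" for c
    proof -
      have "[x (Inl c) = \<xi> + int p ^ a * int c] (mod int p ^ Suc a)"
        using PiE_mem[OF x InlI_I[OF that]] by (simp add: X_def cls_def)
      then show ?thesis using cong_refine[of "Suc a" B] B p_gt_0 by (metis Suc_leI)
    qed
    then obtain \<theta>' where \<theta>': "\<And>c. c \<in> S \<Longrightarrow> \<theta>' c < p ^ (B - Suc a)"
      "\<And>c. c \<in> S \<Longrightarrow> [x (Inl c) = \<xi> + int p ^ a * int c + int p ^ Suc a * int (\<theta>' c)] (mod int p ^ B)"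
      by metis
    \<comment> \<open>The classes are read off from \<open>x\<close>; by \<open>agree\<close> they
      are also those of \<open>y\<close>. Restriction to \<open>S\<close> makes
      \<open>\<theta>\<close> extensional, as membership in \<open>T\<close> demands.\<close>
    define \<theta> where "\<theta> = restrict \<theta>' S"
    have "\<theta> \<in> T" using \<theta>' by (auto simp: T_def \<theta>_def)
    moreover have "x \<in> Pi\<^sub>E I (Y \<theta>)"
    proof (rule PiE_I)
      fix i assume i: "i \<in> I"
      then show "x i \<in> Y \<theta> i"
        using PiE_mem[OF x i] \<theta>' by (auto simp: I_def X_def Y_def \<theta>_def cls_def)
    qed (rule PiE_arb[OF x])
    moreover have "y \<in> Pi\<^sub>E I (Y \<theta>)"
    proof (rule PiE_I)
      fix i assume i: "i \<in> I"
      have "[y (Inl c) = \<xi> + int p ^ a * int c + int p ^ Suc a * int (\<theta> c)] (mod int p ^ B)" if "c \<in> S" for c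
        using \<theta>'(2)[OF that] agree[OF that] that by (simp add: \<theta>_def) (metis cong_sym cong_trans)
      with i show "y i \<in> Y \<theta> i"
        using PiE_mem[OF y i] by (auto simp: I_def X_def Y_def cls_def)
    qed (rule PiE_arb[OF y])
    ultimately show "(x, y) \<in> (\<Union>\<theta>\<in>T. power_sum_solutions k I (Y \<theta>))"
      using xy by (auto simp: power_sum_solutions_def)
  qed
  then have "card (power_sum_solutions k I X) \<le> card (\<Union>\<theta>\<in>T. power_sum_solutions k I (Y \<theta>))" if "finite T"
    using that I by (intro card_mono finite_UN_I finite_power_sum_solutions) (auto simp: Y_def)
  moreover have "finite T" unfolding T_def using finS by (intro finite_PiE) auto
  ultimately have "card (power_sum_solutions k I X) \<le> (\<Sum>\<theta>\<in>T. card (power_sum_solutions k I (Y \<theta>)))"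
    using card_UN_le[of T] order_trans by blast
  then have "real (card (power_sum_solutions k I X)) \<le> (\<Sum>\<theta>\<in>T. real (card (power_sum_solutions k I (Y \<theta>))))"
    by (simp flip: of_nat_sum)
  then show ?thesis by (simp only: mX mY T_def)
qed

end

subsection \<open>Mixed mean values\<close>

text \<open>\<open>H\<close> stands for \<open>C p\<^bsup>(s+\<Delta>)M\<^esup>\<close>, so that the bounds below do not mention \<open>M\<close>.\<close>
locale congruencing_setup = char_mean k p M N s for k p M N s +
  fixes r t m :: nat and H \<Delta> \<kappa> :: real
  assumes rt: "r + t = Suc k" "2 \<le> r" "r \<le> t" "3 \<le> t" and s_eq: "s = r * t" and m_eq: "m = r * (t - 1)"
    and k_less: "k < p"
    and large: "2 * (2 * real r) ^ (2 * m) \<le> real p powr (1 / 2)"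
    and H: "0 < H"
    and J_bound: "\<And>a. a \<le> M \<Longrightarrow> real (vino_count s k (p ^ (M - a))) \<le> H * real p powr (- (real s + \<Delta>) * a)"
    and \<kappa>: "0 < \<kappa>" "4 * \<kappa> \<le> \<Delta>"
begin

abbreviation P :: real where "P \<equiv> real p"

lemma P_ge_1: "1 \<le> P"
  using p prime_ge_1_nat by simp

lemma P_pos: "0 < P"
  by simp

lemma s_eq_m: "s = m + r"
  using rt(4) by (cases t) (simp_all add: s_eq m_eq)

lemma real_m: "real m = real r * (real t - 1)"
  using rt(4) by (simp add: m_eq of_nat_diff)

text \<open>Hoelder's inequality with weights \<open>n1 / s\<close> and \<open>n2 / s\<close>
  separates the two classes into pure \<open>2 s\<close>-th moments, each controlled by
  \<open>J_bound\<close> after rescaling.\<close>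

lemma mean_mixed:
  assumes "n1 + n2 = s" "0 < n1" "0 < n2" "a \<le> M" "b \<le> M"
  shows "mean k N (\<lambda>\<alpha>. g a \<xi> \<alpha> ^ (2 * n1) * g b \<eta> \<alpha> ^ (2 * n2))
    \<le> H * P powr (- ((real s + \<Delta>) * (a * n1 + b * n2) / s))"
proof -
  define \<theta> where "\<theta> = real n1 / real s"
  have s: "0 < real s" using assms by linarith
  have \<theta>: "0 < \<theta>" "\<theta> < 1" "1 - \<theta> = real n2 / real s"
    using assms s by (auto simp: \<theta>_def field_simps)
  have "mean k N (\<lambda>\<alpha>. g a \<xi> \<alpha> ^ (2 * n1) * g b \<eta> \<alpha> ^ (2 * n2))
    = mean k N (\<lambda>\<alpha>. (g a \<xi> \<alpha> ^ (2 * s)) powr \<theta> * (g b \<eta> \<alpha> ^ (2 * s)) powr (1 - \<theta>))"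
  proof -
    have "(g a \<xi> \<alpha> ^ (2 * s)) powr \<theta> = g a \<xi> \<alpha> ^ (2 * n1)"
      "(g b \<eta> \<alpha> ^ (2 * s)) powr (1 - \<theta>) = g b \<eta> \<alpha> ^ (2 * n2)" for \<alpha>
    proof -
      have "real (2 * s) * \<theta> = real (2 * n1)" "real (2 * s) * (1 - \<theta>) = real (2 * n2)"
        using s by (simp_all add: \<theta>(3)) (simp add: \<theta>_def)
      then show "(g a \<xi> \<alpha> ^ (2 * s)) powr \<theta> = g a \<xi> \<alpha> ^ (2 * n1)"
        "(g b \<eta> \<alpha> ^ (2 * s)) powr (1 - \<theta>) = g b \<eta> \<alpha> ^ (2 * n2)"
        using assms by (simp_all only: power_powr_eq_power[OF g_nonneg] mult_pos_pos zero_less_numeral)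
    qed
    then show ?thesis by simp
  qed
  also have "\<dots> \<le> mean k N (\<lambda>\<alpha>. g a \<xi> \<alpha> ^ (2 * s)) powr \<theta> * mean k N (\<lambda>\<alpha>. g b \<eta> \<alpha> ^ (2 * s)) powr (1 - \<theta>)"
    using \<theta> by (intro mean_Holder) auto
  also have "\<dots> \<le> (H * P powr (- (real s + \<Delta>) * a)) powr \<theta> * (H * P powr (- (real s + \<Delta>) * b)) powr (1 - \<theta>)"
    using \<theta> assms order_trans[OF mean_g_le J_bound]
    by (intro mult_mono powr_mono2) (auto intro: mean_nonneg)
  also have "\<dots> = (H powr \<theta> * H powr (1 - \<theta>)) * (P powr (- (real s + \<Delta>) * a * \<theta>) * P powr (- (real s + \<Delta>) * b * (1 - \<theta>)))"
    using H P_pos by (simp add: powr_mult powr_powr mult_ac)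
  also have "H powr \<theta> * H powr (1 - \<theta>) = H"
    using H by (simp flip: powr_add)
  also have "P powr (- (real s + \<Delta>) * a * \<theta>) * P powr (- (real s + \<Delta>) * b * (1 - \<theta>))
    = P powr (- ((real s + \<Delta>) * (a * n1 + b * n2) / s))"
  proof -
    have ex: "- x * a * \<theta> + - x * b * (1 - \<theta>) = - (x * (a * n1 + b * n2) / s)" for x :: real
      unfolding \<theta>(3) by (simp add: \<theta>_def add_divide_distrib distrib_left mult.assoc)
    show ?thesis unfolding powr_add[symmetric] ex ..
  qed
  finally show ?thesis .
qed

text \<open>
  The terms \<open>m a + r b\<close> are the contribution of the diagonal solutions; the other two measure the saving. The slope \<open>\<mu>\<close> is increased step by step until it exceeds \<open>r\<close>.
\<close>
definition target :: "real \<Rightarrow> nat \<Rightarrow> nat \<Rightarrow> real" where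
  "target \<mu> a b = real m * a + real r * b + \<mu> * (real b - real a) + \<kappa> * a"

text \<open>Uniformity in the classes is what permits iteration: a congruencing step moves
  \<open>\<eta>\<close> into the first place and puts a refinement of the class of
  \<open>\<xi>\<close> into the second.\<close>

definition mixed_bound :: "real \<Rightarrow> nat \<Rightarrow> nat \<Rightarrow> bool" where
  "mixed_bound \<mu> a b \<longleftrightarrow> (\<forall>\<xi> \<eta>. \<not> [\<xi> = \<eta>] (mod int p) \<longrightarrow>
    mean k N (\<lambda>\<alpha>. g a \<xi> \<alpha> ^ (2 * m) * g b \<eta> \<alpha> ^ (2 * r)) \<le> H * P powr (- target \<mu> a b))"

lemma \<Delta>_pos: "0 < \<Delta>"
  using \<kappa> by linarith

lemma m_pos: "0 < m"
  using rt by (simp add: m_eq)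

text \<open>Starting point of the iteration. As \<open>a \<le> b\<close>, the average
  \<open>(m a + r b) / s\<close> is at least \<open>a\<close>, so the surplus
  \<open>\<Delta>\<close> in \<open>mean_mixed\<close> yields at least
  \<open>\<Delta> a \<ge> \<kappa> a\<close>; the slope term vanishes in both cases.\<close>

lemma mixed_bound_trivial:
  assumes "a \<le> b" "b \<le> M" "\<mu> = 0 \<or> a = b"
  shows "mixed_bound \<mu> a b"
  unfolding mixed_bound_def
proof (intro allI impI)
  fix \<xi> \<eta>
  have s: "0 < real s" "real s = real m + real r" using s_eq_m m_pos by auto
  have "real a * real s \<le> real a * m + real b * r"
    using assms(1) by (simp add: s(2) distrib_left mult_right_mono)
  then have "\<Delta> * a \<le> \<Delta> * (a * m + b * r) / s"
    using s \<Delta>_pos by (simp add: pos_le_divide_eq mult_left_mono mult.assoc)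
  moreover have "\<kappa> * a \<le> \<Delta> * a" using \<kappa> by (intro mult_right_mono) auto
  moreover have "(real s + \<Delta>) * (a * m + b * r) / s = a * m + b * r + \<Delta> * (a * m + b * r) / s"
    using s by (simp add: field_simps)
  ultimately have "target \<mu> a b \<le> (real s + \<Delta>) * (a * m + b * r) / s"
    using assms(3) by (auto simp: target_def algebra_simps)
  then have "P powr (- ((real s + \<Delta>) * (a * m + b * r) / s)) \<le> P powr (- target \<mu> a b)"
    using P_ge_1 by (intro powr_mono) auto
  then have "H * P powr (- ((real s + \<Delta>) * (a * m + b * r) / s)) \<le> H * P powr (- target \<mu> a b)"
    using H by simp
  then show "mean k N (\<lambda>\<alpha>. g a \<xi> \<alpha> ^ (2 * m) * g b \<eta> \<alpha> ^ (2 * r)) \<le> H * P powr (- target \<mu> a b)"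
    using mean_mixed[of m r a b \<xi> \<eta>] s_eq_m m_pos rt assms by force
qed

lemma not_cong_shift:
  assumes "1 \<le> a" "\<not> [\<xi> = \<eta>] (mod int p)"
  shows "\<not> [\<xi> + int p ^ a * x = \<eta>] (mod int p)"
proof -
  have "[\<xi> + int p ^ a * x = \<xi>] (mod int p)"
    using assms(1) by (simp add: cong_iff_dvd_diff dvd_power)
  then show ?thesis using assms(2) by (meson cong_sym cong_trans)
qed

text \<open>
  Here \<open>B = t b - (t - 1) a\<close>, which does not exceed the level \<open>t b - (r - 1) a\<close> reached by \<open>congruencing\<close>.
\<close>
lemma congruencing_bound:
  assumes S: "S \<subseteq> {..<p}" "card S = r" and ab: "1 \<le> a" "a < b" and \<xi>\<eta>: "\<not> [\<xi> = \<eta>] (mod int p)"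
    and B: "B = b + (t - 1) * (b - a)" and mb: "mixed_bound \<mu> b B"
  shows "mean k N (\<lambda>\<alpha>. (\<Prod>c\<in>S. (g (Suc a) (\<xi> + int p ^ a * int c) \<alpha>)\<^sup>2) * g b \<eta> \<alpha> ^ (2 * m))
    \<le> real r * H * P powr (real r * (real B - real a - 1) - target \<mu> b B)"
proof -
  have finS: "finite S" using S(1) finite_subset by blast
  have aB: "a < B" using ab B by simp
  have "real B + real a * r \<le> real t * b + a"
  proof -
    have "real B = b + (real t - 1) * (real b - real a)" using B ab rt by (simp add: of_nat_diff)
    moreover have "real a * r \<le> real a * t" using rt by (intro mult_left_mono) auto
    ultimately show ?thesis by (simp add: algebra_simps)
  qed
  then have "real (B + a * card S) \<le> real (t * b + a)" by (simp add: S)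
  then have Bt: "B + a * card S \<le> t * b + a" by (simp only: of_nat_le_iff)
  have "mean k N (\<lambda>\<alpha>. (\<Prod>c\<in>S. (g (Suc a) (\<xi> + int p ^ a * int c) \<alpha>)\<^sup>2) * g b \<eta> \<alpha> ^ (2 * m))
    \<le> (\<Sum>\<theta>\<in>S \<rightarrow>\<^sub>E {..<p ^ (B - Suc a)}. mean k N (\<lambda>\<alpha>.
        (\<Prod>c\<in>S. (g B (\<xi> + int p ^ a * int c + int p ^ Suc a * int (\<theta> c)) \<alpha>)\<^sup>2) * g b \<eta> \<alpha> ^ (2 * m)))"
    using rt s_eq_m S by (intro congruencing[OF _ _ _ _ k_less ab(1) \<xi>\<eta> aB Bt]) auto
  also have "\<dots> \<le> real (card (S \<rightarrow>\<^sub>E {..<p ^ (B - Suc a)})) * (real r * (H * P powr (- target \<mu> b B)))"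
  proof (rule sum_bounded_above)
    fix \<theta> :: "nat \<Rightarrow> nat"
    let ?z = "\<lambda>c. \<xi> + int p ^ a * int c + int p ^ Suc a * int (\<theta> c)"
    have "mean k N (\<lambda>\<alpha>. (\<Prod>c\<in>S. (g B (?z c) \<alpha>)\<^sup>2) * g b \<eta> \<alpha> ^ (2 * m))
      \<le> mean k N (\<lambda>\<alpha>. \<Sum>c\<in>S. g b \<eta> \<alpha> ^ (2 * m) * g B (?z c) \<alpha> ^ (2 * r))"
    proof (rule mean_mono)
      fix \<alpha>
      have "S \<noteq> {}" using S rt by auto
      then have "(\<Prod>c\<in>S. (g B (?z c) \<alpha>)\<^sup>2) \<le> (\<Sum>c\<in>S. ((g B (?z c) \<alpha>)\<^sup>2) ^ card S)"
        using finS by (intro prod_le_sum_power) auto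
      then have "(\<Prod>c\<in>S. (g B (?z c) \<alpha>)\<^sup>2) * g b \<eta> \<alpha> ^ (2 * m)
        \<le> (\<Sum>c\<in>S. ((g B (?z c) \<alpha>)\<^sup>2) ^ card S) * g b \<eta> \<alpha> ^ (2 * m)"
        by (intro mult_right_mono) auto
      then show "(\<Prod>c\<in>S. (g B (?z c) \<alpha>)\<^sup>2) * g b \<eta> \<alpha> ^ (2 * m)
        \<le> (\<Sum>c\<in>S. g b \<eta> \<alpha> ^ (2 * m) * g B (?z c) \<alpha> ^ (2 * r))"
        by (simp add: S sum_distrib_left sum_distrib_right mult.commute flip: power_mult)
    qed
    also have "\<dots> = (\<Sum>c\<in>S. mean k N (\<lambda>\<alpha>. g b \<eta> \<alpha> ^ (2 * m) * g B (?z c) \<alpha> ^ (2 * r)))"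
      by (rule mean_sum)
    \<comment> \<open>The roles are exchanged here: \<open>\<eta>\<close> at level \<open>b\<close>
      carries the power \<open>2 m\<close>, and the refined class at level \<open>B\<close> the
      power \<open>2 r\<close>.\<close>
    also have "\<dots> \<le> real (card S) * (H * P powr (- target \<mu> b B))"
    proof (rule sum_bounded_above)
      fix c assume "c \<in> S"
      have "?z c = \<xi> + int p ^ a * (int c + int p * int (\<theta> c))" by (simp add: algebra_simps)
      then have "\<not> [?z c = \<eta>] (mod int p)" using not_cong_shift[OF ab(1) \<xi>\<eta>] by (simp only: simp_thms)
      then have "\<not> [\<eta> = ?z c] (mod int p)" by (rule contrapos_nn) (erule cong_sym)
      then show "mean k N (\<lambda>\<alpha>. g b \<eta> \<alpha> ^ (2 * m) * g B (?z c) \<alpha> ^ (2 * r)) \<le> H * P powr (- target \<mu> b B)"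
        by (rule mb[unfolded mixed_bound_def, rule_format])
    qed
    finally show "mean k N (\<lambda>\<alpha>. (\<Prod>c\<in>S. (g B (?z c) \<alpha>)\<^sup>2) * g b \<eta> \<alpha> ^ (2 * m))
      \<le> real r * (H * P powr (- target \<mu> b B))" by (simp add: S)
  qed
  also have "real (card (S \<rightarrow>\<^sub>E {..<p ^ (B - Suc a)})) = P powr (real r * (real B - real a - 1))"
  proof -
    have "real (card (S \<rightarrow>\<^sub>E {..<p ^ (B - Suc a)})) = P ^ ((B - Suc a) * r)"
      using finS S by (simp add: card_PiE power_mult)
    also have "\<dots> = P powr real ((B - Suc a) * r)" by (rule powr_realpow[symmetric]) simp
    also have "real ((B - Suc a) * r) = real r * (real B - real a - 1)"
      using aB by (simp add: of_nat_diff mult.commute)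
    finally show ?thesis .
  qed
  also have "P powr (real r * (real B - real a - 1)) * (real r * (H * P powr (- target \<mu> b B)))
    = real r * H * P powr (real r * (real B - real a - 1) - target \<mu> b B)"
    by (simp add: powr_diff powr_minus divide_inverse mult_ac)
  finally show ?thesis .
qed

text \<open>Hoelder's inequality with \<open>\<theta> = 1 / (t - 1)\<close>: since
  \<open>m \<theta> = r\<close>, the integrand interpolates between \<open>G\<close> times the
  \<open>2 m\<close>-th power for \<open>\<eta>\<close>, bounded by
  \<open>congruencing_bound\<close>, and \<open>G\<close> times the \<open>2 m\<close>-th power for
  \<open>\<xi>\<close>, bounded by \<open>mean_mixed\<close>. As
  \<open>B - b = (t - 1) (b - a)\<close>, the slope \<open>\<mu>\<close> survives the factor
  \<open>\<theta>\<close>; the term \<open>\<kappa> b \<theta>\<close> pays for the increment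
  \<open>\<sigma>\<close>, and \<open>\<Delta> a (1 - \<theta>) \<ge> 2 \<kappa> a\<close> pays for
  the \<open>\<kappa> a\<close> in \<open>target\<close> and for the additional saving.\<close>

lemma broad_bound:
  assumes S: "S \<subseteq> {..<p}" "card S = r" and ab: "1 \<le> a" "a < b" "b \<le> M" and \<xi>\<eta>: "\<not> [\<xi> = \<eta>] (mod int p)"
    and B: "B = b + (t - 1) * (b - a)" and mb: "mixed_bound \<mu> b B"
    and \<sigma>: "\<sigma> * (real t - 1) \<le> \<kappa>"
  shows "mean k N (\<lambda>\<alpha>. (\<Prod>c\<in>S. (g (Suc a) (\<xi> + int p ^ a * int c) \<alpha>)\<^sup>2) * g a \<xi> \<alpha> ^ (2 * m - 2 * r) * g b \<eta> \<alpha> ^ (2 * r))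
    \<le> real r * H * P powr (- target (\<mu> + \<sigma>) a b - \<kappa> * a)"
proof -
  define G where "G \<alpha> = (\<Prod>c\<in>S. (g (Suc a) (\<xi> + int p ^ a * int c) \<alpha>)\<^sup>2)" for \<alpha>
  define \<theta> where "\<theta> = 1 / (real t - 1)"
  have finS: "finite S" using S(1) finite_subset by blast
  have t3: "3 \<le> real t" using rt by linarith
  have \<theta>: "0 < \<theta>" "\<theta> < 1" "\<theta> * (real t - 1) = 1" "\<theta> \<le> 1 / 2" using t3 by (auto simp: \<theta>_def field_simps)
  have G0: "0 \<le> G \<alpha>" for \<alpha> unfolding G_def by (intro prod_nonneg) auto
  have "2 * r < 2 * m" using rt m_eq by (auto simp: m_eq)
  have "real m * \<theta> = real r * (\<theta> * (real t - 1))" by (simp add: real_m mult_ac)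
  then have m\<theta>: "real m * \<theta> = real r" by (simp only: \<theta>(3) mult_1_right)
  have e: "G \<alpha> * g a \<xi> \<alpha> ^ (2 * m - 2 * r) * g b \<eta> \<alpha> ^ (2 * r)
    = (G \<alpha> * g b \<eta> \<alpha> ^ (2 * m)) powr \<theta> * (G \<alpha> * g a \<xi> \<alpha> ^ (2 * m)) powr (1 - \<theta>)" for \<alpha>
  proof -
    have "(g b \<eta> \<alpha> ^ (2 * m)) powr \<theta> = g b \<eta> \<alpha> ^ (2 * r)"
      using rt \<theta> by (intro power_powr_eq_power) (auto simp: m\<theta>)
    moreover have "(g a \<xi> \<alpha> ^ (2 * m)) powr (1 - \<theta>) = g a \<xi> \<alpha> ^ (2 * m - 2 * r)"
      using \<open>2 * r < 2 * m\<close> m\<theta> by (intro power_powr_eq_power) (auto simp: of_nat_diff right_diff_distrib)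
    moreover have "G \<alpha> powr \<theta> * G \<alpha> powr (1 - \<theta>) = G \<alpha>"
      using G0[of \<alpha>] powr_add[of "G \<alpha>" \<theta> "1 - \<theta>"] by simp
    ultimately show ?thesis using G0[of \<alpha>] by (simp add: powr_mult mult_ac)
  qed
  define E1 where "E1 = real r * (real B - real a - 1) - target \<mu> b B"
  define E2 where "E2 = - (real s + \<Delta>) * a"
  have 1: "mean k N (\<lambda>\<alpha>. G \<alpha> * g b \<eta> \<alpha> ^ (2 * m)) \<le> real r * H * P powr E1"
    unfolding G_def E1_def using S ab B mb \<xi>\<eta> by (intro congruencing_bound) auto
  have 2: "mean k N (\<lambda>\<alpha>. G \<alpha> * g a \<xi> \<alpha> ^ (2 * m)) \<le> real r * H * P powr E2"
  proof -
    have "mean k N (\<lambda>\<alpha>. G \<alpha> * g a \<xi> \<alpha> ^ (2 * m))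
      \<le> mean k N (\<lambda>\<alpha>. \<Sum>c\<in>S. g (Suc a) (\<xi> + int p ^ a * int c) \<alpha> ^ (2 * r) * g a \<xi> \<alpha> ^ (2 * m))"
    proof (rule mean_mono)
      fix \<alpha>
      have "S \<noteq> {}" using S rt by auto
      then have "G \<alpha> \<le> (\<Sum>c\<in>S. ((g (Suc a) (\<xi> + int p ^ a * int c) \<alpha>)\<^sup>2) ^ card S)"
        unfolding G_def using finS by (intro prod_le_sum_power) auto
      then have "G \<alpha> * g a \<xi> \<alpha> ^ (2 * m) \<le> (\<Sum>c\<in>S. ((g (Suc a) (\<xi> + int p ^ a * int c) \<alpha>)\<^sup>2) ^ card S) * g a \<xi> \<alpha> ^ (2 * m)"
        by (intro mult_right_mono) auto
      then show "G \<alpha> * g a \<xi> \<alpha> ^ (2 * m)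
        \<le> (\<Sum>c\<in>S. g (Suc a) (\<xi> + int p ^ a * int c) \<alpha> ^ (2 * r) * g a \<xi> \<alpha> ^ (2 * m))"
        by (simp add: S sum_distrib_right flip: power_mult)
    qed
    also have "\<dots> = (\<Sum>c\<in>S. mean k N (\<lambda>\<alpha>. g (Suc a) (\<xi> + int p ^ a * int c) \<alpha> ^ (2 * r) * g a \<xi> \<alpha> ^ (2 * m)))"
      by (rule mean_sum)
    also have "\<dots> \<le> real (card S) * (H * P powr E2)"
    proof (rule sum_bounded_above)
      fix c
      have "mean k N (\<lambda>\<alpha>. g (Suc a) (\<xi> + int p ^ a * int c) \<alpha> ^ (2 * r) * g a \<xi> \<alpha> ^ (2 * m))
        \<le> H * P powr (- ((real s + \<Delta>) * (Suc a * r + a * m) / s))"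
        using mean_mixed[of r m "Suc a" a] s_eq_m m_pos rt ab by simp
      also have "\<dots> \<le> H * P powr E2"
      proof -
        have s: "0 < real s" "real s = real m + real r" using s_eq_m m_pos by auto
        have "real a * s \<le> Suc a * r + a * m" by (simp add: s(2) algebra_simps)
        then have "(real s + \<Delta>) * (real a * s) / s \<le> (real s + \<Delta>) * (Suc a * r + a * m) / s"
          using s \<Delta>_pos by (intro divide_right_mono mult_left_mono) auto
        then have "- ((real s + \<Delta>) * (Suc a * r + a * m) / s) \<le> E2"
          using s unfolding E2_def by (simp only: nonzero_mult_div_cancel_right mult.assoc[symmetric])
        then show ?thesis using H P_ge_1 by (intro mult_left_mono powr_mono) auto
      qed
      finally show "mean k N (\<lambda>\<alpha>. g (Suc a) (\<xi> + int p ^ a * int c) \<alpha> ^ (2 * r) * g a \<xi> \<alpha> ^ (2 * m)) \<le> H * P powr E2" .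
    qed
    finally show ?thesis by (simp add: S)
  qed
  have "mean k N (\<lambda>\<alpha>. G \<alpha> * g a \<xi> \<alpha> ^ (2 * m - 2 * r) * g b \<eta> \<alpha> ^ (2 * r))
    \<le> mean k N (\<lambda>\<alpha>. G \<alpha> * g b \<eta> \<alpha> ^ (2 * m)) powr \<theta> * mean k N (\<lambda>\<alpha>. G \<alpha> * g a \<xi> \<alpha> ^ (2 * m)) powr (1 - \<theta>)"
    unfolding e using \<theta> G0 by (intro mean_Holder) auto
  also have "\<dots> \<le> (real r * H * P powr E1) powr \<theta> * (real r * H * P powr E2) powr (1 - \<theta>)"
    using \<theta> 1 2 G0 by (intro mult_mono powr_mono2) (auto intro!: mean_nonneg)
  also have "\<dots> = ((real r * H) powr \<theta> * (real r * H) powr (1 - \<theta>)) * (P powr (E1 * \<theta>) * P powr (E2 * (1 - \<theta>)))"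
    using H by (simp add: powr_mult powr_powr mult_ac)
  also have "(real r * H) powr \<theta> * (real r * H) powr (1 - \<theta>) = real r * H"
    using powr_add[of "real r * H" \<theta> "1 - \<theta>"] H by simp
  also have "P powr (E1 * \<theta>) * P powr (E2 * (1 - \<theta>)) = P powr (E1 * \<theta> + E2 * (1 - \<theta>))"
    by (simp add: powr_add)
  also have "real r * H * P powr (E1 * \<theta> + E2 * (1 - \<theta>)) \<le> real r * H * P powr (- target (\<mu> + \<sigma>) a b - \<kappa> * a)"
  proof -
    have Br: "real B - real b = (real t - 1) * (real b - real a)"
      using B ab rt by (simp add: of_nat_diff)
    \<comment> \<open>The \<open>r B\<close> from the choice of classes modulo \<open>p^B\<close>
      cancels the \<open>r B\<close> inside \<open>target \<mu> b B\<close>.\<close>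
    have E1_eq: "E1 = - real r * (real a + 1) - real r * (real t - 1) * b - \<mu> * ((real t - 1) * (real b - real a)) - \<kappa> * b"
      unfolding E1_def target_def Br real_m by (simp add: algebra_simps)
    have "E1 * \<theta> = - real r * (real a + 1) * \<theta> - real r * b * (\<theta> * (real t - 1)) - \<mu> * (real b - real a) * (\<theta> * (real t - 1)) - \<kappa> * b * \<theta>"
      unfolding E1_eq by (simp add: algebra_simps)
    then have E1: "E1 * \<theta> = - real r * (real a + 1) * \<theta> - real r * b - \<mu> * (real b - real a) - \<kappa> * b * \<theta>"
      by (simp only: \<theta>(3) mult_1_right)
    have E2: "E2 * (1 - \<theta>) = - real r * a * (real t * (1 - \<theta>)) - \<Delta> * a * (1 - \<theta>)"
      by (simp add: E2_def s_eq algebra_simps)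
    \<comment> \<open>This turns \<open>s a (1 - \<theta>)\<close> into
      \<open>m a - r a \<theta>\<close>, whose last term cancels against
      \<open>E1 * \<theta>\<close>.\<close>
    have tt: "real t * (1 - \<theta>) = real t - 1 - \<theta>" using \<theta>(3) by (simp add: algebra_simps)
    have "E1 * \<theta> + E2 * (1 - \<theta>)
      = - real r * \<theta> - real m * a - real r * b - \<mu> * (real b - real a) - \<kappa> * b * \<theta> - \<Delta> * a * (1 - \<theta>)"
      unfolding E1 E2 tt real_m by (simp add: algebra_simps)
    moreover have "0 \<le> real r * \<theta>" using \<theta> by simp
    moreover have "2 * \<kappa> * a \<le> \<Delta> * a * (1 - \<theta>)"
    proof -
      have "2 * \<kappa> \<le> \<Delta> * (1 / 2)" using \<kappa> by simp
      also have "\<dots> \<le> \<Delta> * (1 - \<theta>)" using \<theta> \<Delta>_pos by (intro mult_left_mono) auto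
      finally have "2 * \<kappa> * a \<le> \<Delta> * (1 - \<theta>) * a" by (intro mult_right_mono) auto
      then show ?thesis by (simp add: mult_ac)
    qed
    moreover have "\<sigma> * (real b - real a) \<le> \<kappa> * b * \<theta>"
    proof -
      have "\<sigma> * (real t - 1) * \<theta> \<le> \<kappa> * \<theta>" using \<sigma> \<theta> by (intro mult_right_mono) auto
      moreover have "\<sigma> * (real t - 1) * \<theta> = \<sigma> * (\<theta> * (real t - 1))" by (simp add: mult_ac)
      ultimately have "\<sigma> \<le> \<kappa> * \<theta>" by (simp only: \<theta>(3) mult_1_right)
      then have "\<sigma> * (real b - real a) \<le> \<kappa> * \<theta> * (real b - real a)"
        using ab by (intro mult_right_mono) auto
      also have "\<dots> \<le> \<kappa> * \<theta> * b" using \<theta> \<kappa> by (intro mult_left_mono) auto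
      finally show ?thesis by (simp add: mult_ac)
    qed
    ultimately have "E1 * \<theta> + E2 * (1 - \<theta>) \<le> - target (\<mu> + \<sigma>) a b - \<kappa> * a"
      unfolding target_def by (simp add: algebra_simps)
    then show ?thesis using H P_ge_1 by (intro mult_left_mono powr_mono) auto
  qed
  finally show ?thesis unfolding G_def .
qed

text \<open>Downward induction on \<open>a\<close>, starting from \<open>a = b\<close>. The narrow
  terms pass to level \<open>a + 1\<close>. This raises \<open>target\<close> by
  \<open>m - (\<mu> + \<sigma>) + \<kappa>\<close>, which is at least \<open>3 / 2\<close> because
  \<open>m \<ge> 2 r\<close>, \<open>r \<ge> 2\<close> and
  \<open>\<mu> + \<sigma> \<le> r + 1 / 2\<close>; it outweighs the \<open>p\<close> classes and
  leaves \<open>p^(-1/2)\<close> against the constant in \<open>large\<close>. The broad terms fall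
  under \<open>broad_bound\<close>, whose additional factor \<open>p^(- \<kappa> a)\<close> absorbs
  all constants through \<open>D\<close>.\<close>

lemma mixed_bound_step:
  fixes a0 a b R :: nat and \<mu> \<sigma> :: real
  assumes a0: "1 \<le> a0" and \<sigma>: "0 \<le> \<sigma>" "\<sigma> * (real t - 1) \<le> \<kappa>" and \<mu>: "\<mu> + \<sigma> \<le> real r + 1 / 2"
    and D: "2 * real r * (2 * P) ^ (2 * r) * 2 ^ p \<le> P powr (\<kappa> * a0)"
    and mb: "\<And>a b. a0 \<le> a \<Longrightarrow> a \<le> b \<Longrightarrow> R * b \<le> M \<Longrightarrow> mixed_bound \<mu> a b"
    and R: "1 \<le> R" and ab: "a0 \<le> a" "a \<le> b" "R * t * b \<le> M"
  shows "mixed_bound (\<mu> + \<sigma>) a b"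
  using ab(2,1)
proof (induction a rule: inc_induct)
  case base
  have "1 \<le> R * t" using R rt by simp
  then have "1 * b \<le> R * t * b" by (rule mult_le_mono1)
  then have "b \<le> M" using ab(3) by linarith
  then show ?case by (intro mixed_bound_trivial) auto
next
  case (step a)
  have "1 \<le> a" using step a0 by simp
  have "1 \<le> R * t" using R rt by simp
  then have "1 * b \<le> R * t * b" by (rule mult_le_mono1)
  then have bM: "b \<le> M" using ab(3) by linarith
  define B where "B = b + (t - 1) * (b - a)"
  \<comment> \<open>\<open>B \<le> t b\<close>, which is why the condition on \<open>b\<close> gains
    a factor \<open>t\<close>.\<close>
  have "B \<le> b + (t - 1) * b" unfolding B_def by simp
  also have "\<dots> = t * b" using rt by (simp add: algebra_simps flip: mult_Suc)
  finally have "R * B \<le> R * (t * b)" by (rule mult_left_mono) simp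
  then have "R * B \<le> M" using ab(3) by (simp only: mult.assoc)
  then have mbB: "mixed_bound \<mu> b B"
    using ab(1) step by (intro mb) (simp_all add: B_def)
  have IH: "mixed_bound (\<mu> + \<sigma>) (Suc a) b" using step by simp
  show ?case unfolding mixed_bound_def
  proof (intro allI impI)
    fix \<xi> \<eta> assume \<xi>\<eta>: "\<not> [\<xi> = \<eta>] (mod int p)"
    define T where "T = H * P powr (- target (\<mu> + \<sigma>) a b)"
    define Ss where "Ss = {S. S \<subseteq> {..<p} \<and> card S = r}"
    have T: "0 < T" using H by (simp add: T_def)
    let ?z = "\<lambda>c. \<xi> + int p ^ a * int c"
    have "mean k N (\<lambda>\<alpha>. g a \<xi> \<alpha> ^ (2 * m) * g b \<eta> \<alpha> ^ (2 * r))
      \<le> mean k N (\<lambda>\<alpha>. (2 * real r) ^ (2 * m) * (\<Sum>c<p. g (Suc a) (?z c) \<alpha> ^ (2 * m) * g b \<eta> \<alpha> ^ (2 * r))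
        + (2 * P) ^ (2 * r) * (\<Sum>S\<in>Ss. (\<Prod>c\<in>S. (g (Suc a) (?z c) \<alpha>)\<^sup>2) * g a \<xi> \<alpha> ^ (2 * m - 2 * r) * g b \<eta> \<alpha> ^ (2 * r)))"
    proof (rule mean_mono)
      fix \<alpha>
      have "g a \<xi> \<alpha> ^ (2 * m) \<le> (2 * real r) ^ (2 * m) * (\<Sum>c<p. g (Suc a) (?z c) \<alpha> ^ (2 * m))
        + (2 * P) ^ (2 * r) * (\<Sum>S\<in>Ss. (\<Prod>c\<in>S. (g (Suc a) (?z c) \<alpha>)\<^sup>2) * g a \<xi> \<alpha> ^ (2 * m - 2 * r))"
        unfolding Ss_def
      proof (rule multilinear_reduction)
        show "g a \<xi> \<alpha> \<le> (\<Sum>c<p. g (Suc a) (?z c) \<alpha>)"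
          using g_le_sum[of a "Suc a" \<xi> \<alpha>] by simp
        show "2 * r \<le> 2 * m" using rt by (simp add: m_eq)
        show "{..<p} \<noteq> {}" using p_gt_0 by (auto simp: lessThan_empty_iff)
      qed (use rt in auto)
      then have "g a \<xi> \<alpha> ^ (2 * m) * g b \<eta> \<alpha> ^ (2 * r) \<le> ((2 * real r) ^ (2 * m) * (\<Sum>c<p. g (Suc a) (?z c) \<alpha> ^ (2 * m))
        + (2 * P) ^ (2 * r) * (\<Sum>S\<in>Ss. (\<Prod>c\<in>S. (g (Suc a) (?z c) \<alpha>)\<^sup>2) * g a \<xi> \<alpha> ^ (2 * m - 2 * r))) * g b \<eta> \<alpha> ^ (2 * r)"
        by (rule mult_right_mono) simp
      then show "g a \<xi> \<alpha> ^ (2 * m) * g b \<eta> \<alpha> ^ (2 * r)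
        \<le> (2 * real r) ^ (2 * m) * (\<Sum>c<p. g (Suc a) (?z c) \<alpha> ^ (2 * m) * g b \<eta> \<alpha> ^ (2 * r))
        + (2 * P) ^ (2 * r) * (\<Sum>S\<in>Ss. (\<Prod>c\<in>S. (g (Suc a) (?z c) \<alpha>)\<^sup>2) * g a \<xi> \<alpha> ^ (2 * m - 2 * r) * g b \<eta> \<alpha> ^ (2 * r))"
        by (simp only: distrib_right mult.assoc sum_distrib_right)
    qed
    also have "\<dots> = (2 * real r) ^ (2 * m) * (\<Sum>c<p. mean k N (\<lambda>\<alpha>. g (Suc a) (?z c) \<alpha> ^ (2 * m) * g b \<eta> \<alpha> ^ (2 * r)))
        + (2 * P) ^ (2 * r) * (\<Sum>S\<in>Ss. mean k N (\<lambda>\<alpha>. (\<Prod>c\<in>S. (g (Suc a) (?z c) \<alpha>)\<^sup>2) * g a \<xi> \<alpha> ^ (2 * m - 2 * r) * g b \<eta> \<alpha> ^ (2 * r)))"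
      by (simp only: mean_add mean_cmult mean_sum)
    also have "\<dots> \<le> T / 2 + T / 2"
    proof (rule add_mono)
      have "(\<Sum>c<p. mean k N (\<lambda>\<alpha>. g (Suc a) (?z c) \<alpha> ^ (2 * m) * g b \<eta> \<alpha> ^ (2 * r)))
        \<le> real (card {..<p}) * (H * P powr (- target (\<mu> + \<sigma>) (Suc a) b))"
        using IH not_cong_shift[OF \<open>1 \<le> a\<close> \<xi>\<eta>] by (intro sum_bounded_above) (auto simp: mixed_bound_def)
      also have "\<dots> \<le> T * P powr (- 1 / 2)"
      proof -
        have "real r * 2 \<le> real m"
          using rt by (simp add: real_m mult_left_mono)
        then have "1 - target (\<mu> + \<sigma>) (Suc a) b \<le> - target (\<mu> + \<sigma>) a b + (- 1 / 2)"
          using \<mu> \<kappa> rt by (simp add: target_def algebra_simps)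
        then have "P powr (1 - target (\<mu> + \<sigma>) (Suc a) b) \<le> P powr (- target (\<mu> + \<sigma>) a b + (- 1 / 2))"
          using P_ge_1 by (rule powr_mono)
        then have "H * (P powr 1 * P powr (- target (\<mu> + \<sigma>) (Suc a) b)) \<le> H * (P powr (- target (\<mu> + \<sigma>) a b) * P powr (- 1 / 2))"
          using H unfolding powr_add[symmetric] by simp
        then show ?thesis by (simp add: T_def mult_ac)
      qed
      finally have "(2 * real r) ^ (2 * m) * (\<Sum>c<p. mean k N (\<lambda>\<alpha>. g (Suc a) (?z c) \<alpha> ^ (2 * m) * g b \<eta> \<alpha> ^ (2 * r)))
        \<le> (P powr (1 / 2) / 2) * (T * P powr (- 1 / 2))"
        using large by (intro mult_mono) (auto intro!: sum_nonneg mean_nonneg)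
      also have "\<dots> = T / 2 * (P powr (1 / 2) * P powr (- 1 / 2))" by simp
      also have "P powr (1 / 2) * P powr (- 1 / 2) = 1" unfolding powr_add[symmetric] by simp
      finally show "(2 * real r) ^ (2 * m) * (\<Sum>c<p. mean k N (\<lambda>\<alpha>. g (Suc a) (?z c) \<alpha> ^ (2 * m) * g b \<eta> \<alpha> ^ (2 * r))) \<le> T / 2"
        by simp
    next
      define W where "W = real r * H * P powr (- target (\<mu> + \<sigma>) a b - \<kappa> * a)"
      have "(\<Sum>S\<in>Ss. mean k N (\<lambda>\<alpha>. (\<Prod>c\<in>S. (g (Suc a) (?z c) \<alpha>)\<^sup>2) * g a \<xi> \<alpha> ^ (2 * m - 2 * r) * g b \<eta> \<alpha> ^ (2 * r)))
        \<le> real (card Ss) * W"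
        unfolding W_def
        using \<open>1 \<le> a\<close> step ab bM mbB \<sigma>(2) \<xi>\<eta> by (intro sum_bounded_above broad_bound[OF _ _ _ _ _ _ B_def]) (auto simp: Ss_def)
      also have "\<dots> \<le> 2 ^ p * W"
      proof (rule mult_right_mono)
        have "card Ss \<le> card (Pow {..<p})" unfolding Ss_def by (intro card_mono) auto
        then have "real (card Ss) \<le> real (2 ^ p)" unfolding of_nat_le_iff by (simp add: card_Pow)
        then show "real (card Ss) \<le> 2 ^ p" by simp
        show "0 \<le> W" using H by (simp add: W_def)
      qed
      finally have "(2 * P) ^ (2 * r) * (\<Sum>S\<in>Ss. mean k N (\<lambda>\<alpha>. (\<Prod>c\<in>S. (g (Suc a) (?z c) \<alpha>)\<^sup>2) * g a \<xi> \<alpha> ^ (2 * m - 2 * r) * g b \<eta> \<alpha> ^ (2 * r)))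
        \<le> (2 * P) ^ (2 * r) * (2 ^ p * W)"
        by (rule mult_left_mono) simp
      also have "\<dots> = (2 * real r * (2 * P) ^ (2 * r) * 2 ^ p) * (T / 2) * P powr (- (\<kappa> * a))"
      proof -
        have W: "W = real r * T * P powr (- (\<kappa> * a))"
          unfolding W_def T_def diff_conv_add_uminus powr_add by (simp only: mult.assoc)
        have "x * (y * (real r * T * z)) = 2 * real r * x * y * (T / 2) * z" for x y z :: real
          by simp
        then show ?thesis unfolding W .
      qed
      also have "\<dots> \<le> P powr (\<kappa> * a) * (T / 2) * P powr (- (\<kappa> * a))"
      proof (intro mult_right_mono)
        have "P powr (\<kappa> * a0) \<le> P powr (\<kappa> * a)"
          using step \<kappa> P_ge_1 by (intro powr_mono mult_left_mono) auto
        then show "2 * real r * (2 * P) ^ (2 * r) * 2 ^ p \<le> P powr (\<kappa> * a)" using D by linarith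
      qed (use T in auto)
      also have "\<dots> = T / 2 * (P powr (\<kappa> * a) * P powr (- (\<kappa> * a)))" by (simp only: mult_ac)
      also have "P powr (\<kappa> * a) * P powr (- (\<kappa> * a)) = 1"
        unfolding powr_add[symmetric] by simp
      finally show "(2 * P) ^ (2 * r) * (\<Sum>S\<in>Ss. mean k N (\<lambda>\<alpha>. (\<Prod>c\<in>S. (g (Suc a) (?z c) \<alpha>)\<^sup>2) * g a \<xi> \<alpha> ^ (2 * m - 2 * r) * g b \<eta> \<alpha> ^ (2 * r))) \<le> T / 2"
        by (simp only: mult_1_right)
    qed
    finally show "mean k N (\<lambda>\<alpha>. g a \<xi> \<alpha> ^ (2 * m) * g b \<eta> \<alpha> ^ (2 * r)) \<le> H * P powr (- target (\<mu> + \<sigma>) a b)"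
      by (simp only: T_def field_sum_of_halves)
  qed
qed

text \<open>Each step adds \<open>\<sigma>\<close> to the slope and costs a factor \<open>t\<close>
  in the admissible range of \<open>b\<close>, whence \<open>t ^ n\<close>.\<close>

lemma mixed_bound_iterated:
  fixes a0 a b n :: nat and \<sigma> :: real
  assumes a0: "1 \<le> a0" and \<sigma>: "0 \<le> \<sigma>" "\<sigma> * (real t - 1) \<le> \<kappa>"
    and D: "2 * real r * (2 * P) ^ (2 * r) * 2 ^ p \<le> P powr (\<kappa> * a0)"
    and n: "real n * \<sigma> \<le> real r + 1 / 2" and ab: "a0 \<le> a" "a \<le> b" "t ^ n * b \<le> M"
  shows "mixed_bound (real n * \<sigma>) a b"
  using n ab
proof (induction n arbitrary: a b)
  case 0
  then have "b \<le> M" by simp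
  then show ?case using 0 by (intro mixed_bound_trivial) simp_all
next
  case (Suc n)
  have Mb: "t ^ n * t * b \<le> M" using Suc.prems(4) by (simp add: mult.commute)
  have n\<sigma>: "real n * \<sigma> + \<sigma> \<le> real r + 1 / 2"
    using Suc.prems(1) by (simp add: algebra_simps)
  then have "real n * \<sigma> \<le> real r + 1 / 2" using \<sigma> by linarith
  note IH = Suc.IH[OF this]
  have tn: "1 \<le> t ^ n" using rt by simp
  have "mixed_bound (real n * \<sigma> + \<sigma>) a b"
    by (rule mixed_bound_step[OF a0 \<sigma> n\<sigma> D IH tn Suc.prems(2,3) Mb])
  then show ?case by (simp add: algebra_simps)
qed

text \<open>A crude descent from level 1 by the power mean inequality: the numbers
  \<open>p^(a0 - 1)\<close> and \<open>p^(b - 1)\<close> of subclasses enter with exponents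
  \<open>2 m\<close> and \<open>2 r\<close>. For large \<open>b\<close> the loss
  \<open>2 r b\<close> is beaten by \<open>target\<close> once the slope exceeds
  \<open>r\<close>.\<close>

lemma mean_level_1_le:
  fixes a0 b n :: nat
  assumes "1 \<le> a0" "1 \<le> b" and mb: "mixed_bound \<mu> a0 b" and \<xi>\<eta>: "\<not> [\<xi> = \<eta>] (mod int p)"
  shows "mean k N (\<lambda>\<alpha>. g 1 \<xi> \<alpha> ^ (2 * m) * g 1 \<eta> \<alpha> ^ (2 * r))
    \<le> H * P powr (2 * real m * a0 + 2 * real r * b - target \<mu> a0 b)"
proof -
  define na nb where "na = p ^ (a0 - 1)" and "nb = p ^ (b - 1)"
  let ?x = "\<lambda>h. \<xi> + int p ^ 1 * int h" and ?y = "\<lambda>h. \<eta> + int p ^ 1 * int h"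
  have pow: "g 1 \<zeta> \<alpha> ^ l \<le> real (p ^ (c - 1)) ^ (l - 1) * (\<Sum>h<p ^ (c - 1). g c (\<zeta> + int p ^ 1 * int h) \<alpha> ^ l)"
    if "1 \<le> c" "1 \<le> l" for c l \<zeta> \<alpha>
  proof -
    have "g 1 \<zeta> \<alpha> ^ l \<le> (\<Sum>h<p ^ (c - 1). g c (\<zeta> + int p ^ 1 * int h) \<alpha>) ^ l"
      using g_le_sum[of 1 c \<zeta> \<alpha>] that by (intro power_mono) auto
    also have "\<dots> \<le> real (card {..<p ^ (c - 1)}) ^ (l - 1) * (\<Sum>h<p ^ (c - 1). g c (\<zeta> + int p ^ 1 * int h) \<alpha> ^ l)"
      using that by (intro power_sum_le_sum_power) auto
    finally show ?thesis by simp
  qed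
  have "mean k N (\<lambda>\<alpha>. g 1 \<xi> \<alpha> ^ (2 * m) * g 1 \<eta> \<alpha> ^ (2 * r))
    \<le> mean k N (\<lambda>\<alpha>. (real na ^ (2 * m - 1) * real nb ^ (2 * r - 1)) *
        (\<Sum>h<na. \<Sum>h'<nb. g a0 (?x h) \<alpha> ^ (2 * m) * g b (?y h') \<alpha> ^ (2 * r)))"
  proof (rule mean_mono)
    fix \<alpha>
    have "g 1 \<xi> \<alpha> ^ (2 * m) * g 1 \<eta> \<alpha> ^ (2 * r)
      \<le> (real na ^ (2 * m - 1) * (\<Sum>h<na. g a0 (?x h) \<alpha> ^ (2 * m))) * (real nb ^ (2 * r - 1) * (\<Sum>h<nb. g b (?y h) \<alpha> ^ (2 * r)))"
      unfolding na_def nb_def using assms m_pos rt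
      by (intro mult_mono pow) (auto intro!: mult_nonneg_nonneg sum_nonneg)
    also have "\<dots> = (real na ^ (2 * m - 1) * real nb ^ (2 * r - 1)) *
        ((\<Sum>h<na. g a0 (?x h) \<alpha> ^ (2 * m)) * (\<Sum>h<nb. g b (?y h) \<alpha> ^ (2 * r)))"
      by (simp only: mult_ac)
    finally show "g 1 \<xi> \<alpha> ^ (2 * m) * g 1 \<eta> \<alpha> ^ (2 * r)
      \<le> (real na ^ (2 * m - 1) * real nb ^ (2 * r - 1)) *
        (\<Sum>h<na. \<Sum>h'<nb. g a0 (?x h) \<alpha> ^ (2 * m) * g b (?y h') \<alpha> ^ (2 * r))"
      by (simp only: sum_product)
  qed
  also have "\<dots> = (real na ^ (2 * m - 1) * real nb ^ (2 * r - 1)) *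
    (\<Sum>h<na. \<Sum>h'<nb. mean k N (\<lambda>\<alpha>. g a0 (?x h) \<alpha> ^ (2 * m) * g b (?y h') \<alpha> ^ (2 * r)))"
    by (simp only: mean_cmult mean_sum)
  also have "\<dots> \<le> (real na ^ (2 * m - 1) * real nb ^ (2 * r - 1)) * (real na * (real nb * (H * P powr (- target \<mu> a0 b))))"
  proof (rule mult_left_mono)
    have "mean k N (\<lambda>\<alpha>. g a0 (?x h) \<alpha> ^ (2 * m) * g b (?y h') \<alpha> ^ (2 * r)) \<le> H * P powr (- target \<mu> a0 b)" for h h'
    proof (rule mb[unfolded mixed_bound_def, rule_format])
      have "[?x h = \<xi>] (mod int p)" "[\<eta> = ?y h'] (mod int p)"
        by (simp_all add: cong_iff_dvd_diff)
      then show "\<not> [?x h = ?y h'] (mod int p)"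
        using \<xi>\<eta> by (meson cong_trans cong_sym)
    qed
    then have "(\<Sum>h<na. \<Sum>h'<nb. mean k N (\<lambda>\<alpha>. g a0 (?x h) \<alpha> ^ (2 * m) * g b (?y h') \<alpha> ^ (2 * r)))
      \<le> (\<Sum>h<na. \<Sum>h'<nb. H * P powr (- target \<mu> a0 b))"
      by (intro sum_mono)
    then show "(\<Sum>h<na. \<Sum>h'<nb. mean k N (\<lambda>\<alpha>. g a0 (?x h) \<alpha> ^ (2 * m) * g b (?y h') \<alpha> ^ (2 * r)))
      \<le> real na * (real nb * (H * P powr (- target \<mu> a0 b)))" by simp
  qed simp
  also have "\<dots> = (real na ^ (2 * m - 1) * real na) * (real nb ^ (2 * r - 1) * real nb) * (H * P powr (- target \<mu> a0 b))"
    by (simp only: mult_ac)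
  also have "real na ^ (2 * m - 1) * real na = real na ^ (2 * m)"
    using m_pos power_minus_mult[of "2 * m" "real na"] by simp
  also have "real nb ^ (2 * r - 1) * real nb = real nb ^ (2 * r)"
    using rt power_minus_mult[of "2 * r" "real nb"] by simp
  also have "real na ^ (2 * m) * real nb ^ (2 * r) * (H * P powr (- target \<mu> a0 b))
    \<le> P powr (2 * real m * a0) * P powr (2 * real r * b) * (H * P powr (- target \<mu> a0 b))"
  proof -
    have *: "real (p ^ (c - 1)) ^ (2 * l) \<le> P powr (2 * real l * c)" for c l
    proof -
      have "real (p ^ (c - 1)) ^ (2 * l) = P ^ ((c - 1) * (2 * l))"
        by (simp add: power_mult)
      also have "\<dots> \<le> P ^ (2 * l * c)"
        using P_ge_1 by (intro power_increasing) auto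
      also have "\<dots> = P powr real (2 * l * c)" by (rule powr_realpow[symmetric]) simp
      finally show ?thesis by simp
    qed
    show ?thesis unfolding na_def nb_def using H by (intro mult_right_mono mult_mono *) auto
  qed
  also have "\<dots> = H * P powr (2 * real m * a0 + 2 * real r * b - target \<mu> a0 b)"
    by (simp only: diff_conv_add_uminus powr_add mult_ac)
  finally show ?thesis .
qed

text \<open>Either one class modulo \<open>p\<close> dominates, giving the term with
  \<open>M - 1\<close>, or two distinct classes are both large. With slope \<open>r + 1 / 2\<close>
  the loss \<open>2 r b\<close> cancels against \<open>target\<close> and leaves a gain
  \<open>b / 2\<close>; what remains of the exponent depends on \<open>a0\<close> only.\<close>

lemma vino_count_recursion:
  fixes a0 b :: nat
  assumes "1 \<le> a0" "a0 \<le> b" "1 \<le> M" and mb: "mixed_bound (real r + 1 / 2) a0 b"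
  shows "real (vino_count s k (p ^ M)) \<le> 16 ^ s * P * real (vino_count s k (p ^ (M - 1)))
    + (2 * P) ^ (2 * s) * P\<^sup>2 * P powr (real m * a0 + (real r + 1 / 2) * a0) * (H * P powr (- real b / 2))"
proof -
  define Y where "Y = P powr (real m * a0 + (real r + 1 / 2) * a0) * (H * P powr (- real b / 2))"
  have Y: "0 \<le> Y" using H by (simp add: Y_def)
  have eq: "2 * m + 2 * r = 2 * s" by (simp add: s_eq_m)
  have "real (vino_count s k (p ^ M)) = mean k N (\<lambda>\<alpha>. g 0 0 \<alpha> ^ (2 * m + 2 * r))"
    unfolding eq by (rule mean_g_0[symmetric]) simp
  also have "\<dots> \<le> mean k N (\<lambda>\<alpha>. 4 ^ (2 * m + 2 * r) * (\<Sum>c<p. g 1 (int c) \<alpha> ^ (2 * m + 2 * r))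
    + (2 * P) ^ (2 * m + 2 * r) * (\<Sum>c<p. \<Sum>d\<in>{..<p}-{c}. g 1 (int c) \<alpha> ^ (2 * m) * g 1 (int d) \<alpha> ^ (2 * r)))"
  proof (rule mean_mono, rule bilinear_reduction)
    show "g 0 0 \<alpha> \<le> (\<Sum>c<p. g 1 (int c) \<alpha>)" for \<alpha>
      using g_le_sum[of 0 1 0 \<alpha>] by simp
    show "{..<p} \<noteq> {}" using p_gt_0 by (auto simp: lessThan_empty_iff)
  qed auto
  also have "\<dots> = 16 ^ s * (\<Sum>c<p. mean k N (\<lambda>\<alpha>. g 1 (int c) \<alpha> ^ (2 * s)))
    + (2 * P) ^ (2 * s) * (\<Sum>c<p. \<Sum>d\<in>{..<p}-{c}. mean k N (\<lambda>\<alpha>. g 1 (int c) \<alpha> ^ (2 * m) * g 1 (int d) \<alpha> ^ (2 * r)))"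
    unfolding eq by (simp only: mean_add mean_cmult mean_sum) (simp add: power_mult)
  also have "\<dots> \<le> 16 ^ s * (P * real (vino_count s k (p ^ (M - 1)))) + (2 * P) ^ (2 * s) * (P\<^sup>2 * Y)"
  proof (intro add_mono mult_left_mono)
    show "(\<Sum>c<p. mean k N (\<lambda>\<alpha>. g 1 (int c) \<alpha> ^ (2 * s))) \<le> P * real (vino_count s k (p ^ (M - 1)))"
      using sum_bounded_above[of "{..<p}" "\<lambda>c. mean k N (\<lambda>\<alpha>. g 1 (int c) \<alpha> ^ (2 * s))"] mean_g_le[of 1] assms by simp
    have "mean k N (\<lambda>\<alpha>. g 1 (int c) \<alpha> ^ (2 * m) * g 1 (int d) \<alpha> ^ (2 * r)) \<le> Y"
      if "c \<in> {..<p}" "d \<in> {..<p} - {c}" for c d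
    proof -
      have "\<not> [int c = int d] (mod int p)"
        using that by (auto simp: cong_int_iff dest: cong_less_modulus_unique_nat)
      then have "mean k N (\<lambda>\<alpha>. g 1 (int c) \<alpha> ^ (2 * m) * g 1 (int d) \<alpha> ^ (2 * r))
        \<le> H * P powr (2 * real m * a0 + 2 * real r * b - target (real r + 1 / 2) a0 b)"
        using assms by (intro mean_level_1_le) auto
      also have "\<dots> \<le> H * P powr (real m * a0 + (real r + 1 / 2) * a0 + - real b / 2)"
      proof (intro mult_left_mono powr_mono)
        have "0 \<le> \<kappa> * a0" using \<kappa> by simp
        moreover have "2 * real m * a0 + 2 * real r * b - target (real r + 1 / 2) a0 b
          = real m * a0 + (real r + 1 / 2) * a0 + - real b / 2 - \<kappa> * a0"
          by (simp add: target_def field_simps)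
        ultimately show "2 * real m * a0 + 2 * real r * b - target (real r + 1 / 2) a0 b
          \<le> real m * a0 + (real r + 1 / 2) * a0 + - real b / 2" by linarith
      qed (use H P_ge_1 in auto)
      also have "\<dots> = Y" by (simp only: Y_def powr_add mult_ac)
      finally show ?thesis .
    qed
    then have "(\<Sum>c<p. \<Sum>d\<in>{..<p}-{c}. mean k N (\<lambda>\<alpha>. g 1 (int c) \<alpha> ^ (2 * m) * g 1 (int d) \<alpha> ^ (2 * r)))
      \<le> (\<Sum>c<p. \<Sum>d\<in>{..<p}-{c}. Y)"
      by (intro sum_mono)
    also have "\<dots> \<le> (\<Sum>c<p. \<Sum>d<p. Y)"
      using Y by (intro sum_mono sum_mono2) auto
    also have "\<dots> = P\<^sup>2 * Y" by (simp add: power2_eq_square)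
    finally show "(\<Sum>c<p. \<Sum>d\<in>{..<p}-{c}. mean k N (\<lambda>\<alpha>. g 1 (int c) \<alpha> ^ (2 * m) * g 1 (int d) \<alpha> ^ (2 * r))) \<le> P\<^sup>2 * Y" .
  qed auto
  finally show ?thesis by (simp only: Y_def mult.assoc)
qed

end

subsection \<open>Lowering the exponent\<close>

lemma vino_count_le: "vino_count s k L \<le> L ^ (2 * s)"
proof -
  let ?T = "{1..s} \<rightarrow>\<^sub>E {0..<int L}"
  have "vino_count s k L \<le> card (?T \<times> ?T)"
    unfolding vino_count_def
    by (rule card_mono) (auto simp: power_sum_solutions_def intro!: finite_cartesian_product finite_PiE)
  also have "\<dots> = L ^ (2 * s)"
    by (simp add: card_cartesian_product card_PiE mult_2 power_add)
  finally show ?thesis .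
qed

text \<open>The gain \<open>\<delta>\<close> is chosen before \<open>\<Delta>\<close> and
  \<open>C\<close>, so that finitely many applications can bring \<open>\<Delta>\<close> down to
  \<open>\<epsilon>\<close>. For large \<open>M\<close> the previous lemma gives a recursion in
  \<open>M\<close>, which is solved by induction.\<close>

lemma exponent_improvement:
  fixes k r t p :: nat and \<epsilon> :: real
  assumes p: "prime p" "k < p" and rt: "r + t = Suc k" "2 \<le> r" "r \<le> t" "3 \<le> t"
    and large: "2 * (2 * real r) ^ (2 * (r * (t - 1))) \<le> real p powr (1 / 2)"
    and large': "2 * 16 ^ (r * t) \<le> real p" and \<epsilon>: "0 < \<epsilon>"
  obtains \<delta> :: real where "0 < \<delta>"
    "\<And>\<Delta> C. \<epsilon> \<le> \<Delta> \<Longrightarrow> 0 < C \<Longrightarrow>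
      (\<And>M. real (vino_count (r * t) k (p ^ M)) \<le> C * real p powr ((real (r * t) + \<Delta>) * M)) \<Longrightarrow>
      \<exists>C'>0. \<forall>M. real (vino_count (r * t) k (p ^ M)) \<le> C' * real p powr ((real (r * t) + \<Delta> - \<delta>) * M)"
proof -
  define P where "P = real p"
  define s where "s = r * t"
  define m where "m = r * (t - 1)"
  \<comment> \<open>This gives \<open>4 \<kappa> \<le> \<Delta>\<close> for every
    \<open>\<Delta> \<ge> \<epsilon>\<close>. The number \<open>n\<close> is so large that
    increments with \<open>n \<sigma> = r + 1 / 2\<close> satisfy
    \<open>\<sigma> (t - 1) \<le> \<kappa>\<close>; \<open>R\<close> is the resulting range factor,
    and \<open>\<delta>\<close> comes from the gain \<open>p^(-b/2)\<close> with \<open>b\<close>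
    about \<open>M / R\<close>.\<close>
  define \<kappa> where "\<kappa> = \<epsilon> / 4"
  define n where "n = Suc (nat \<lceil>(real r + 1 / 2) * (real t - 1) / \<kappa>\<rceil>)"
  define \<sigma> where "\<sigma> = (real r + 1 / 2) / n"
  define R where "R = t ^ n"
  define \<delta> where "\<delta> = 1 / (2 * real R)"
  define D where "D = 2 * real r * (2 * P) ^ (2 * r) * 2 ^ p"
  \<comment> \<open>Chosen so that \<open>p^(\<kappa> a0)\<close> is at least the constant
    \<open>D\<close> of the broad case.\<close>
  define a0 where "a0 = Suc (nat \<lceil>log P D / \<kappa>\<rceil>)"
  have P1: "1 < P" using p(1) prime_gt_1_nat by (simp add: P_def)
  have \<kappa>: "0 < \<kappa>" using \<epsilon> by (simp add: \<kappa>_def)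
  have n0: "0 < real n" by (simp add: n_def)
  have n\<sigma>: "real n * \<sigma> = real r + 1 / 2" using n0 by (simp add: \<sigma>_def)
  have \<sigma>0: "0 \<le> \<sigma>" by (simp add: \<sigma>_def)
  have \<sigma>t: "\<sigma> * (real t - 1) \<le> \<kappa>"
  proof -
    have "(real r + 1 / 2) * (real t - 1) / \<kappa> \<le> real n"
      unfolding n_def by linarith
    then show ?thesis using \<kappa> n0 by (simp add: \<sigma>_def field_simps)
  qed
  have R1: "1 \<le> R" using rt by (simp add: R_def)
  have \<delta>: "0 < \<delta>" "\<delta> \<le> 1 / 2" using R1 by (auto simp: \<delta>_def field_simps)
  have a0: "1 \<le> a0" by (simp add: a0_def)
  have Da0: "D \<le> P powr (\<kappa> * a0)"
  proof -
    have "0 < D" using P1 rt by (simp add: D_def)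
    have "log P D / \<kappa> \<le> real a0" unfolding a0_def by linarith
    then have "log P D \<le> \<kappa> * a0" using \<kappa> by (simp add: field_simps)
    then show ?thesis using P1 \<open>0 < D\<close> by (simp add: log_le_iff)
  qed
  show thesis
  proof (rule that[OF \<delta>(1)])
    fix \<Delta> C :: real
    assume \<Delta>: "\<epsilon> \<le> \<Delta>" and C: "0 < C"
      and hyp: "\<And>M. real (vino_count (r * t) k (p ^ M)) \<le> C * real p powr ((real (r * t) + \<Delta>) * M)"
    define x where "x = real s + \<Delta>"
    have hyp': "real (vino_count s k (p ^ M)) \<le> C * P powr (x * M)" for M
      using hyp[of M] by (simp only: P_def s_def x_def)
    \<comment> \<open>The last factor compensates for the rounding in
      \<open>M div R\<close>.\<close>
    define K where "K = (2 * P) ^ (2 * s) * P\<^sup>2 * P powr (real m * a0 + (real r + 1 / 2) * a0) * P powr (1 / 2)"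
    have K: "0 < K" using P1 by (simp add: K_def)
    \<comment> \<open>For \<open>M \<ge> M0\<close> the level \<open>M div R\<close> is at least
      \<open>a0\<close>.\<close>
    define M0 where "M0 = R * a0"
    have M0: "1 \<le> M0" using R1 a0 by (simp add: M0_def)
    have rec: "real (vino_count s k (p ^ M)) \<le> 16 ^ s * P * real (vino_count s k (p ^ (M - 1)))
      + K * C * P powr ((x - \<delta>) * M)" if M: "M0 \<le> M" for M
    proof -
      define b where "b = M div R"
      define H where "H = C * P powr (x * M)"
      have b: "a0 \<le> b" "R * b \<le> M"
        using div_le_mono[OF M, of R] R1 by (simp_all add: b_def M0_def)
      interpret congruencing_setup k p M "Suc (s * (p ^ M) ^ k)" s r t m H \<Delta> \<kappa>
      proof
        show "0 < H" using C P1 by (simp add: H_def)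
        show "real (vino_count s k (p ^ (M - a))) \<le> H * real p powr (- (real s + \<Delta>) * a)" if "a \<le> M" for a
        proof -
          have "C * P powr (x * real (M - a)) = H * P powr (- x * a)"
            using that by (simp add: H_def of_nat_diff right_diff_distrib mult.assoc flip: powr_add)
          then show ?thesis using hyp'[of "M - a"] by (simp only: P_def x_def)
        qed
        show "2 * (2 * real r) ^ (2 * m) \<le> real p powr (1 / 2)" using large by (simp only: m_def)
        show "4 * \<kappa> \<le> \<Delta>" using \<Delta> by (simp add: \<kappa>_def)
      qed (use p rt \<kappa> in \<open>simp_all add: s_def m_def\<close>)
      have mb: "mixed_bound (real n * \<sigma>) a0 b"
        by (rule mixed_bound_iterated[OF a0 \<sigma>0 \<sigma>t])
          (use Da0 b n\<sigma> in \<open>simp_all add: D_def P_def R_def\<close>)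
      have "real (vino_count s k (p ^ M)) \<le> 16 ^ s * P * real (vino_count s k (p ^ (M - 1)))
        + (2 * P) ^ (2 * s) * P\<^sup>2 * P powr (real m * a0 + (real r + 1 / 2) * a0) * (H * P powr (- real b / 2))"
        unfolding P_def using vino_count_recursion[OF a0 b(1) _ mb[unfolded n\<sigma>]] M M0 by linarith
      also have "H * P powr (- real b / 2) \<le> P powr (1 / 2) * (C * P powr ((x - \<delta>) * M))"
      proof -
        have "M < R * b + R" using dividend_less_times_div[of R M] R1 by (simp add: b_def add.commute)
        then have "real M < real (R * b + R)" by (simp only: of_nat_less_iff)
        then have "\<delta> * M \<le> \<delta> * (real R * b + real R)" using \<delta> by (intro mult_left_mono) auto
        also have "\<dots> = (real b + 1) / 2" using R1 by (simp add: \<delta>_def field_simps)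
        finally have "x * M + - real b / 2 \<le> 1 / 2 + (x - \<delta>) * M" by (simp add: algebra_simps)
        then have "P powr (x * M + - real b / 2) \<le> P powr (1 / 2 + (x - \<delta>) * M)"
          using P1 by (intro powr_mono) auto
        then have "C * (P powr (x * M) * P powr (- real b / 2)) \<le> C * (P powr (1 / 2) * P powr ((x - \<delta>) * M))"
          using C unfolding powr_add[symmetric] by simp
        then show ?thesis by (simp only: H_def mult_ac)
      qed
      finally have "real (vino_count s k (p ^ M)) \<le> 16 ^ s * P * real (vino_count s k (p ^ (M - 1)))
        + (2 * P) ^ (2 * s) * P\<^sup>2 * P powr (real m * a0 + (real r + 1 / 2) * a0) * (P powr (1 / 2) * (C * P powr ((x - \<delta>) * M)))"
        using P1 by (simp add: mult_left_mono)
      then show ?thesis by (simp only: K_def mult.assoc)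
    qed
    \<comment> \<open>The first summand covers \<open>M < M0\<close> directly from
      \<open>hyp\<close>; the second lets half of \<open>C'\<close> take care of the term with
      \<open>K\<close>.\<close>
    define C' where "C' = C * P powr (\<delta> * M0) + 2 * K * C"
    have C': "0 < C'" "C * P powr (\<delta> * M0) \<le> C'" "2 * K * C \<le> C'"
      using C K P1 by (auto simp: C'_def intro!: add_pos_pos)
    have "real (vino_count s k (p ^ M)) \<le> C' * P powr ((x - \<delta>) * M)" for M
    proof (induction M)
      case 0
      have "C * 1 \<le> C * P powr (\<delta> * M0)"
        using C P1 \<delta> by (intro mult_left_mono ge_one_powr_ge_zero) auto
      then show ?case using hyp'[of 0] P1 C' by simp
    next
      case (Suc M)
      show ?case
      proof (cases "M0 \<le> Suc M")
        case False
        have "P powr (x * Suc M) = P powr (\<delta> * Suc M) * P powr ((x - \<delta>) * Suc M)"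
          unfolding powr_add[symmetric] by (simp only: distrib_right[symmetric]) simp
        also have "\<dots> \<le> P powr (\<delta> * M0) * P powr ((x - \<delta>) * Suc M)"
          using False P1 \<delta> by (intro mult_right_mono powr_mono mult_left_mono) auto
        finally have "C * P powr (x * Suc M) \<le> (C * P powr (\<delta> * M0)) * P powr ((x - \<delta>) * Suc M)"
          using C by (simp add: mult.assoc)
        also have "\<dots> \<le> C' * P powr ((x - \<delta>) * Suc M)" using C' by (intro mult_right_mono) auto
        finally show ?thesis using hyp'[of "Suc M"] by linarith
      next
        case True
        let ?Z = "P powr ((x - \<delta>) * Suc M)"
        have "16 ^ s * P * real (vino_count s k (p ^ M)) \<le> 16 ^ s * P * (C' * P powr ((x - \<delta>) * M))"
          using Suc.IH P1 by (intro mult_left_mono) auto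
        also have "\<dots> \<le> C' / 2 * ?Z"
        proof -
          \<comment> \<open>The narrow term loses \<open>2 * 16^s * p\<close>, at most
            \<open>p^2\<close> by \<open>large'\<close>, whereas the passage from \<open>M\<close>
            to \<open>Suc M\<close> gains \<open>p^(x - \<delta>)\<close> with
            \<open>x - \<delta> \<ge> 2\<close>.\<close>
          have "2 * 16 ^ s * P \<le> P * P" using large' P1 by (simp add: P_def s_def)
          also have "P * P = P powr 2" using P1 by (simp add: power2_eq_square)
          also have "\<dots> \<le> P powr (x - \<delta>)"
          proof (rule powr_mono)
            have "2 * 3 \<le> r * t" using rt by (intro mult_mono) auto
            then have "6 \<le> real s" unfolding s_def by linarith
            then show "2 \<le> x - \<delta>" using \<Delta> \<epsilon> \<delta> by (simp add: x_def)
          qed (use P1 in simp)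
          finally have "2 * 16 ^ s * P * (C' / 2 * P powr ((x - \<delta>) * M)) \<le> P powr (x - \<delta>) * (C' / 2 * P powr ((x - \<delta>) * M))"
            using C' by (intro mult_right_mono) auto
          also have "\<dots> = C' / 2 * (P powr (x - \<delta>) * P powr ((x - \<delta>) * M))" by (simp only: mult_ac)
          also have "P powr (x - \<delta>) * P powr ((x - \<delta>) * M) = ?Z"
            unfolding powr_add[symmetric] by (simp add: algebra_simps)
          finally show ?thesis by simp
        qed
        finally have "16 ^ s * P * real (vino_count s k (p ^ M)) \<le> C' / 2 * ?Z" .
        moreover have "K * C * ?Z \<le> C' / 2 * ?Z" using C' by (intro mult_right_mono) auto
        moreover have "C' / 2 * ?Z + C' / 2 * ?Z = C' * ?Z" by simp
        ultimately show ?thesis using rec[OF True] by simp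
      qed
    qed
    then show "\<exists>C'>0. \<forall>M. real (vino_count (r * t) k (p ^ M)) \<le> C' * real p powr ((real (r * t) + \<Delta> - \<delta>) * M)"
      using C'(1) by (auto simp: P_def s_def x_def)
  qed
qed

text \<open>The iteration starts from the trivial exponent \<open>2 s\<close> and lowers it by
  \<open>\<delta>\<close> at a time; the maximum with \<open>\<epsilon>\<close> keeps
  \<open>\<Delta>\<close> in the range where the improvement applies.\<close>

lemma vino_count_prime_power_bound:
  fixes k r t p :: nat and \<epsilon> :: real
  assumes p: "prime p" "k < p" and rt: "r + t = Suc k" "2 \<le> r" "r \<le> t" "3 \<le> t"
    and large: "2 * (2 * real r) ^ (2 * (r * (t - 1))) \<le> real p powr (1 / 2)"
    and large': "2 * 16 ^ (r * t) \<le> real p" and \<epsilon>: "0 < \<epsilon>"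
  shows "\<exists>C>0. \<forall>M. real (vino_count (r * t) k (p ^ M)) \<le> C * real p powr ((real (r * t) + \<epsilon>) * M)"
proof -
  define s where "s = r * t"
  obtain \<delta> where \<delta>: "0 < \<delta>"
    "\<And>\<Delta> C. \<epsilon> \<le> \<Delta> \<Longrightarrow> 0 < C \<Longrightarrow>
      (\<And>M. real (vino_count s k (p ^ M)) \<le> C * real p powr ((real s + \<Delta>) * M)) \<Longrightarrow>
      \<exists>C'>0. \<forall>M. real (vino_count s k (p ^ M)) \<le> C' * real p powr ((real s + \<Delta> - \<delta>) * M)"
    using exponent_improvement[OF assms] unfolding s_def by blast
  have P1: "1 < real p" using p(1) prime_gt_1_nat by simp
  have mono: "C * real p powr (x * real M) \<le> C * real p powr (y * real M)" if "x \<le> y" "0 < C" for x y C M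
    using that P1 by (intro mult_left_mono powr_mono mult_right_mono) auto
  have "\<exists>C>0. \<forall>M. real (vino_count s k (p ^ M)) \<le> C * real p powr ((real s + max \<epsilon> (real s - n * \<delta>)) * M)" for n :: nat
  proof (induction n)
    case 0
    have "real (vino_count s k (p ^ M)) \<le> 1 * real p powr ((real s + max \<epsilon> (real s)) * M)" for M
    proof -
      have "real (vino_count s k (p ^ M)) \<le> real ((p ^ M) ^ (2 * s))"
        unfolding of_nat_le_iff by (rule vino_count_le)
      also have "\<dots> = real p ^ (2 * s * M)" by (simp add: mult_ac flip: power_mult)
      also have "\<dots> = 1 * real p powr (real (2 * s) * real M)"
        using P1 by (simp add: powr_realpow flip: of_nat_mult)
      also have "\<dots> \<le> 1 * real p powr ((real s + max \<epsilon> (real s)) * M)"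
        by (rule mono) auto
      finally show ?thesis .
    qed
    then show ?case by (intro exI[of _ 1]) simp
  next
    case (Suc n)
    then obtain C where C: "0 < C" "\<And>M. real (vino_count s k (p ^ M)) \<le> C * real p powr ((real s + max \<epsilon> (real s - n * \<delta>)) * M)"
      by blast
    obtain C' where C': "0 < C'" "\<And>M. real (vino_count s k (p ^ M)) \<le> C' * real p powr ((real s + max \<epsilon> (real s - n * \<delta>) - \<delta>) * M)"
      using \<delta>(2)[OF _ C] by auto
    have "real s + max \<epsilon> (real s - n * \<delta>) - \<delta> \<le> real s + max \<epsilon> (real s - Suc n * \<delta>)"
      using \<delta>(1) by (auto simp: algebra_simps max_def)
    then show ?case using C' mono by (meson order_trans)
  qed
  moreover obtain n :: nat where "real s / \<delta> < n" using reals_Archimedean2 by blast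
  then have "max \<epsilon> (real s - n * \<delta>) = \<epsilon>"
    using \<delta>(1) \<epsilon> by (simp add: field_simps)
  ultimately show ?thesis unfolding s_def by metis
qed

section \<open>From \<open>s = r t\<close> and prime powers to smaller \<open>s\<close> and real
  \<open>X\<close>\<close>

lemma (in char_mean) vino_count_Holder:
  assumes "1 \<le> s'" "s' < s"
  shows "real (vino_count s' k (p ^ M)) \<le> real (vino_count s k (p ^ M)) powr (real s' / real s)"
proof -
  define \<theta> where "\<theta> = real s' / real s"
  have \<theta>: "0 < \<theta>" "\<theta> < 1" "real (2 * s) * \<theta> = real (2 * s')"
    using assms by (auto simp: \<theta>_def)
  have "0 < N" using N by (rule le_less_trans[OF le0])
  then have one: "mean k N (\<lambda>_. 1 :: real) = 1" by (simp add: mean_def card_PiE)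
  have "real (vino_count s' k (p ^ M)) = mean k N (\<lambda>\<alpha>. g 0 0 \<alpha> ^ (2 * s'))"
    using assms by (intro mean_g_0[symmetric]) simp
  \<comment> \<open>Hoelder's inequality is applied against the constant 1, whose mean is 1.\<close>
  also have "\<dots> = mean k N (\<lambda>\<alpha>. (g 0 0 \<alpha> ^ (2 * s)) powr \<theta> * 1 powr (1 - \<theta>))"
  proof -
    have "(g 0 0 \<alpha> ^ (2 * s)) powr \<theta> = g 0 0 \<alpha> ^ (2 * s')" for \<alpha>
      by (rule power_powr_eq_power[OF g_nonneg _ \<theta>(3)]) (use assms in simp)
    then show ?thesis by simp
  qed
  also have "\<dots> \<le> mean k N (\<lambda>\<alpha>. g 0 0 \<alpha> ^ (2 * s)) powr \<theta> * mean k N (\<lambda>_. 1) powr (1 - \<theta>)"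
    using \<theta> by (intro mean_Holder) auto
  also have "mean k N (\<lambda>\<alpha>. g 0 0 \<alpha> ^ (2 * s)) = real (vino_count s k (p ^ M))"
    by (rule mean_g_0) simp
  finally show ?thesis by (simp add: one \<theta>_def)
qed

lemma vinogradov_J_le:
  assumes "X < real L"
  shows "vinogradov_J s k X \<le> vino_count s k L"
  unfolding vinogradov_J_def vino_count_def
proof (rule card_mono)
  show "finite (power_sum_solutions k {1..s} (\<lambda>_. {0..<int L}))"
    by (rule finite_power_sum_solutions) auto
  have "{n. 1 \<le> n \<and> real_of_int n \<le> X} \<subseteq> {0..<int L}"
    using assms by auto
  then have "{1..s} \<rightarrow>\<^sub>E {n. 1 \<le> n \<and> real_of_int n \<le> X} \<subseteq> {1..s} \<rightarrow>\<^sub>E {0..<int L}"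
    by (intro PiE_mono)
  then show "vinogradov_solutions s k X \<subseteq> power_sum_solutions k {1..s} (\<lambda>_. {0..<int L})"
    by (auto simp: vinogradov_solutions_def power_sum_solutions_def sum_subtractf)
qed

theorem theorem1p1:
  fixes k s :: nat and \<epsilon> :: real
  assumes "k \<ge> 4"
    and "1 \<le> s" and "real s \<le> 1 / 4 * (real k + 1) ^ 2"
    and "\<epsilon> > 0"
  shows "\<exists>C>0. \<forall>X\<ge>1. real (vinogradov_J s k X) \<le> C * X powr (real s + \<epsilon>)"
proof -
  \<comment> \<open>The most balanced splitting of \<open>k + 1\<close>, for which
    \<open>r t\<close> is the integer part of \<open>(k + 1)^2 / 4\<close>.\<close>
  define r where "r = (k + 1) div 2"
  define t where "t = k + 1 - r"
  define s0 where "s0 = r * t"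
  have rt: "r + t = Suc k" "2 \<le> r" "r \<le> t" "3 \<le> t"
    using assms(1) by (auto simp: r_def t_def)
  have s_le: "s \<le> s0"
  proof -
    have "real (4 * s) \<le> real ((k + 1) ^ 2)" using assms(3) by (simp add: add.commute)
    then have "4 * s \<le> (r + t) ^ 2" unfolding of_nat_le_iff using rt(1) by simp
    moreover have "t = r \<or> t = Suc r" by (auto simp: r_def t_def)
    then have "(r + t) ^ 2 \<le> 4 * s0 + 1" by (auto simp: s0_def power2_eq_square algebra_simps)
    ultimately show ?thesis by linarith
  qed
  have s0: "0 < s0" using rt by (simp add: s0_def)
  \<comment> \<open>A single prime above three thresholds is fixed; squaring the first one accounts
    for the square root of \<open>p\<close> in \<open>large\<close>.\<close>
  define Q where "Q = (2 * (2 * real r) ^ (2 * (r * (t - 1))))\<^sup>2 + 2 * 16 ^ (r * t) + real k"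
  obtain p :: nat where p: "prime p" "nat \<lceil>Q\<rceil> < p" using bigger_prime by blast
  then have Qp: "Q < real p" by linarith
  define P where "P = real p"
  have P1: "1 < P" using p(1) prime_gt_1_nat by (simp add: P_def)
  have "real k < real p" and large': "2 * 16 ^ (r * t) \<le> real p"
    and sq: "(2 * (2 * real r) ^ (2 * (r * (t - 1))))\<^sup>2 \<le> real p"
    using Qp zero_le_power2[of "2 * (2 * real r) ^ (2 * (r * (t - 1)))"] zero_le_power[of "16::real" "r * t"]
    unfolding Q_def by linarith+
  then have "k < p" by simp
  have large: "2 * (2 * real r) ^ (2 * (r * (t - 1))) \<le> real p powr (1 / 2)"
    using real_le_rsqrt[OF sq] by (simp add: powr_half_sqrt)
  obtain C where C: "0 < C" "\<And>M. real (vino_count s0 k (p ^ M)) \<le> C * P powr ((real s0 + \<epsilon>) * M)"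
    using vino_count_prime_power_bound[OF p(1) \<open>k < p\<close> rt large large' assms(4)]
    unfolding s0_def P_def by blast
  define \<theta> where "\<theta> = real s / real s0"
  have \<theta>: "0 < \<theta>" "\<theta> \<le> 1" using assms(2) s_le s0 by (auto simp: \<theta>_def)
  have count: "real (vino_count s k (p ^ M)) \<le> C powr \<theta> * P powr ((real s + \<epsilon>) * M)" for M
  proof -
    have "real (vino_count s k (p ^ M)) \<le> real (vino_count s0 k (p ^ M)) powr \<theta>"
    proof (cases "s = s0")
      case True
      then show ?thesis using s0 by (simp add: \<theta>_def)
    next
      case False
      interpret char_mean k p M "Suc (s0 * (p ^ M) ^ k)" s0
        by standard (use p in auto)
      show ?thesis unfolding \<theta>_def using False s_le assms(2) by (intro vino_count_Holder) auto
    qed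
    also have "\<dots> \<le> (C * P powr ((real s0 + \<epsilon>) * M)) powr \<theta>"
      using C \<theta> by (intro powr_mono2) auto
    also have "\<dots> = C powr \<theta> * P powr ((real s0 + \<epsilon>) * M * \<theta>)"
      using C P1 by (simp add: powr_mult powr_powr)
    also have "\<dots> \<le> C powr \<theta> * P powr ((real s + \<epsilon>) * M)"
    proof (intro mult_left_mono powr_mono)
      have "(real s0 + \<epsilon>) * \<theta> = real s + \<epsilon> * \<theta>" using s0 by (simp add: \<theta>_def field_simps)
      also have "\<dots> \<le> real s + \<epsilon>" using \<theta> assms(4) by (simp add: mult_left_le)
      finally have "(real s0 + \<epsilon>) * \<theta> * M \<le> (real s + \<epsilon>) * M" by (intro mult_right_mono) auto
      then show "(real s0 + \<epsilon>) * M * \<theta> \<le> (real s + \<epsilon>) * M" by (simp only: mult_ac)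
    qed (use P1 in auto)
    finally show ?thesis .
  qed
  define C1 where "C1 = C powr \<theta> * P powr (real s + \<epsilon>)"
  have "real (vinogradov_J s k X) \<le> C1 * X powr (real s + \<epsilon>)" if X: "1 \<le> X" for X
  proof -
    \<comment> \<open>\<open>p ^ M\<close> is the least power of \<open>p\<close> exceeding
      \<open>X\<close>, hence at most \<open>p X\<close>; this costs only the constant factor
      \<open>p^(s + \<epsilon>)\<close>.\<close>
    define M where "M = Suc (nat \<lfloor>log P X\<rfloor>)"
    have lg: "0 \<le> log P X" using X P1 by simp
    have M: "log P X < real M" "real M \<le> log P X + 1" using lg by (auto simp: M_def) linarith+
    have "X < P powr real M" using M(1) X P1 by (simp add: log_less_iff)
    then have "X < real (p ^ M)" using P1 by (simp add: powr_realpow P_def)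
    then have "real (vinogradov_J s k X) \<le> real (vino_count s k (p ^ M))"
      unfolding of_nat_le_iff by (rule vinogradov_J_le)
    also have "\<dots> \<le> C powr \<theta> * P powr ((real s + \<epsilon>) * M)" by (rule count)
    also have "\<dots> \<le> C powr \<theta> * P powr ((real s + \<epsilon>) * (log P X + 1))"
      using M(2) P1 assms(4) by (intro mult_left_mono powr_mono) auto
    also have "P powr ((real s + \<epsilon>) * (log P X + 1)) = P powr (real s + \<epsilon>) * (P powr log P X) powr (real s + \<epsilon>)"
      unfolding powr_powr powr_add[symmetric] by (simp add: algebra_simps)
    also have "P powr log P X = X" using P1 X by simp
    finally show ?thesis by (simp only: C1_def mult.assoc)
  qed
  moreover have "0 < C1" using C P1 by (simp add: C1_def)
  ultimately show ?thesis by blast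
qed

end
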